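(* Let $P \in NCB_{\mathcal{D}}(B(\mathcal{H}))$ be an idempotent with symbol $\Gamma(P) = \chi_A$, where $A\subseteq X\times X$. Then the set $A$ is marginally equivalent to the $\omega$-support of $\mathcal{M} = P(B(\mathcal{H}))$, i.e. the two sets differ by a marginally null set.
   Context: $(X,\mu)$ is a standard finite Borel measure space, $\mathcal{H}=L^2(X,\mu)$ (separable) and $\mathcal{D}=L^\infty(X,\mu)$ acts on $\mathcal{H}$ by multiplication operators $M_f$. A linear map $\Phi$ on $B(\mathcal{H})$ is a $\mathcal{D}$-bimodule map if $\Phi(D_1TD_2)=D_1\Phi(T)D_2$ for all $T\in B(\mathcal{H})$, $D_1,D_2\in\mathcal{D}$. $NCB_{\mathcal{D}}(B(\mathcal{H}))$ is the algebra (under composition) of all w*-continuous $\mathcal{D}$-bimodule maps from $B(\mathcal{H})$ into itself; idempotent means $P\circ P=P$. A set $R\subseteq X\times X$ is marginally null if $R\subseteq (N\times X)\cup(X\times N)$ for some $\mu$-null set $N$; two functions on $X\times X$ are equal marginally almost everywhere (m.a.e.) if the set where they differ is marginally null. A set $E\subseteq X\times X$ is $\omega$-open if it differs from a countable union of Borel rectangles by a marginally null set, and $\omega$-closed if its complement is $\omega$-open. Symbol: every $\Phi\in NCB_{\mathcal{D}}(B(\mathcal{H}))$ can be written (Haagerup) as $\Phi(T)=\sum_{n=1}^\infty M_{f_n}TM_{g_n}$ (w*-convergent) with Borel functions $f_n,g_n:X\to\mathbb{C}$ such that $\sum_n|f_n(s)|^2$ and $\sum_n|g_n(s)|^2$ converge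 for all $s\in X$ and are bounded in $s$. The symbol $\Gamma(\Phi)$ is the m.a.e. equivalence class of the Borel function $\phi(s,t)=\sum_n f_n(s)g_n(t)$; it does not depend on the chosen representation. The equality $\Gamma(P)=\chi_A$ (with $\chi_A$ the indicator function of $A$) is m.a.e. $\omega$-support: for a Borel set $\beta\subseteq X$ let $M_\beta$ be the projection of $L^2(X,\mu)$ onto $L^2(\beta)$. A set $\Omega\subseteq X\times X$ supports a space $\mathcal{S}$ of operators on $L^2(X,\mu)$ if $M_\alpha\mathcal{S}M_\beta=\{0\}$ for every Borel rectangle $\alpha\times\beta$ that does not meet $\Omega$. There is an $\omega$-closed set supporting $\mathcal{S}$ that is minimal up to marginally null sets among $\omega$-closed sets supporting $\mathcal{S}$ (i.e. it is contained, up to a marginally null set, in every other such set); it is unique up to marginally null sets and is called the $\omega$-support of $\mathcal{S}$. *)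

theory Defs
  imports "HOL-Analysis.Analysis"
begin

definition standard_borel_measure :: "'a measure \<Rightarrow> bool" where
  "standard_borel_measure M \<longleftrightarrow>
     (\<exists>T. topspace T = space M \<and> completely_metrizable_space T \<and> second_countable T \<and>
          sets M = sigma_sets (space M) {U. openin T U})"


section \<open>The Hilbert space of square-integrable functions\<close>

text \<open>
  Elements of \<open>L2 M\<close> are classes of square-integrable complex functions modulo equality
  almost everywhere; operations on classes are computed on chosen representatives.
\<close>

definition sq_integrable :: "'a measure \<Rightarrow> ('a \<Rightarrow> complex) set" where
  "sq_integrable M = {f \<in> borel_measurable M. integrable M (\<lambda>x. (cmod (f x))\<^sup>2)}"

definition ae_rel :: "'a measure \<Rightarrow> (('a \<Rightarrow> complex) \<times> ('a \<Rightarrow> complex)) set" where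
  "ae_rel M = {(f, g). f \<in> sq_integrable M \<and> g \<in> sq_integrable M \<and> (AE x in M. f x = g x)}"

definition L2 :: "'a measure \<Rightarrow> ('a \<Rightarrow> complex) set set" where
  "L2 M = sq_integrable M // ae_rel M"

definition L2_class :: "'a measure \<Rightarrow> ('a \<Rightarrow> complex) \<Rightarrow> ('a \<Rightarrow> complex) set" where
  "L2_class M f = ae_rel M `` {f}"

definition L2_rep :: "('a \<Rightarrow> complex) set \<Rightarrow> 'a \<Rightarrow> complex" where
  "L2_rep u = (SOME f. f \<in> u)"

definition L2_zero :: "'a measure \<Rightarrow> ('a \<Rightarrow> complex) set" where
  "L2_zero M = L2_class M (\<lambda>x. 0)"

definition L2_add ::
  "'a measure \<Rightarrow> ('a \<Rightarrow> complex) set \<Rightarrow> ('a \<Rightarrow> complex) set \<Rightarrow> ('a \<Rightarrow> complex) set" where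
  "L2_add M u v = L2_class M (\<lambda>x. L2_rep u x + L2_rep v x)"

definition L2_scale ::
  "'a measure \<Rightarrow> complex \<Rightarrow> ('a \<Rightarrow> complex) set \<Rightarrow> ('a \<Rightarrow> complex) set" where
  "L2_scale M c u = L2_class M (\<lambda>x. c * L2_rep u x)"

definition L2_inner ::
  "'a measure \<Rightarrow> ('a \<Rightarrow> complex) set \<Rightarrow> ('a \<Rightarrow> complex) set \<Rightarrow> complex" where
  "L2_inner M u v = (LINT x|M. L2_rep u x * cnj (L2_rep v x))"

definition L2_norm :: "'a measure \<Rightarrow> ('a \<Rightarrow> complex) set \<Rightarrow> real" where
  "L2_norm M u = sqrt (LINT x|M. (cmod (L2_rep u x))\<^sup>2)"


section \<open>Bounded operators and the weak* topology\<close>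

type_synonym 'a l2op = "('a \<Rightarrow> complex) set \<Rightarrow> ('a \<Rightarrow> complex) set"

text \<open>Operators are extensional, so that HOL equality is equality of operators on \<open>L2 M\<close>.\<close>

definition BH :: "'a measure \<Rightarrow> 'a l2op set" where
  "BH M = {T \<in> L2 M \<rightarrow>\<^sub>E L2 M.
     (\<forall>u\<in>L2 M. \<forall>v\<in>L2 M. T (L2_add M u v) = L2_add M (T u) (T v)) \<and>
     (\<forall>c. \<forall>u\<in>L2 M. T (L2_scale M c u) = L2_scale M c (T u)) \<and>
     (\<exists>C. \<forall>u\<in>L2 M. L2_norm M (T u) \<le> C * L2_norm M u)}"

definition op_zero :: "'a measure \<Rightarrow> 'a l2op" where
  "op_zero M = (\<lambda>u\<in>L2 M. L2_zero M)"

definition op_add :: "'a measure \<Rightarrow> 'a l2op \<Rightarrow> 'a l2op \<Rightarrow> 'a l2op" where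
  "op_add M S T = (\<lambda>u\<in>L2 M. L2_add M (S u) (T u))"

definition op_scale :: "'a measure \<Rightarrow> complex \<Rightarrow> 'a l2op \<Rightarrow> 'a l2op" where
  "op_scale M c T = (\<lambda>u\<in>L2 M. L2_scale M c (T u))"

definition op_comp :: "'a measure \<Rightarrow> 'a l2op \<Rightarrow> 'a l2op \<Rightarrow> 'a l2op" where
  "op_comp M S T = compose (L2 M) S T"

primrec op_sum :: "'a measure \<Rightarrow> (nat \<Rightarrow> 'a l2op) \<Rightarrow> nat \<Rightarrow> 'a l2op" where
  "op_sum M S 0 = op_zero M"
| "op_sum M S (Suc n) = op_add M (op_sum M S n) (S n)"

text \<open>
  The weak* topology of \<open>B(H)\<close> as the dual of the trace class operators: the coarsest topology
  making continuous all functionals \<open>T \<mapsto> \<Sum>n. \<langle>T x\<^sub>n, y\<^sub>n\<rangle>\<close> with square-summable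
  sequences of vectors \<open>x\<^sub>n\<close> and \<open>y\<^sub>n\<close>.
\<close>

definition l2_seq :: "'a measure \<Rightarrow> (nat \<Rightarrow> ('a \<Rightarrow> complex) set) \<Rightarrow> bool" where
  "l2_seq M x \<longleftrightarrow> (\<forall>n. x n \<in> L2 M) \<and> summable (\<lambda>n. (L2_norm M (x n))\<^sup>2)"

definition wstar_topology :: "'a measure \<Rightarrow> 'a l2op topology" where
  "wstar_topology M = topology_generated_by
     {{T \<in> BH M. (\<Sum>n. L2_inner M (T (x n)) (y n)) \<in> U} | x y U.
        l2_seq M x \<and> l2_seq M y \<and> open U}"


section \<open>Multiplication operators and normal bimodule maps\<close>

definition Linf :: "'a measure \<Rightarrow> ('a \<Rightarrow> complex) set" where
  "Linf M = {f \<in> borel_measurable M. \<exists>C. AE x in M. cmod (f x) \<le> C}"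

definition mult_op :: "'a measure \<Rightarrow> ('a \<Rightarrow> complex) \<Rightarrow> 'a l2op" where
  "mult_op M f = (\<lambda>u\<in>L2 M. L2_class M (\<lambda>x. f x * L2_rep u x))"

definition diag_alg :: "'a measure \<Rightarrow> 'a l2op set" where
  "diag_alg M = mult_op M ` Linf M"

definition proj_op :: "'a measure \<Rightarrow> 'a set \<Rightarrow> 'a l2op" where
  "proj_op M \<beta> = mult_op M (indicator \<beta>)"

text \<open>Only the values of \<open>\<Phi>\<close> on \<open>BH M\<close> are relevant.\<close>

definition NCB :: "'a measure \<Rightarrow> ('a l2op \<Rightarrow> 'a l2op) set" where
  "NCB M = {\<Phi>. \<Phi> \<in> BH M \<rightarrow> BH M \<and>
     (\<forall>S\<in>BH M. \<forall>T\<in>BH M. \<Phi> (op_add M S T) = op_add M (\<Phi> S) (\<Phi> T)) \<and>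
     (\<forall>c. \<forall>T\<in>BH M. \<Phi> (op_scale M c T) = op_scale M c (\<Phi> T)) \<and>
     continuous_map (wstar_topology M) (wstar_topology M) \<Phi> \<and>
     (\<forall>T\<in>BH M. \<forall>D\<^sub>1\<in>diag_alg M. \<forall>D\<^sub>2\<in>diag_alg M.
        \<Phi> (op_comp M D\<^sub>1 (op_comp M T D\<^sub>2)) = op_comp M D\<^sub>1 (op_comp M (\<Phi> T) D\<^sub>2))}"

definition idempotent_map :: "'a measure \<Rightarrow> ('a l2op \<Rightarrow> 'a l2op) \<Rightarrow> bool" where
  "idempotent_map M \<Phi> \<longleftrightarrow> (\<forall>T\<in>BH M. \<Phi> (\<Phi> T) = \<Phi> T)"


section \<open>Marginal equivalence and the pseudo-topology\<close>

definition marg_null :: "'a measure \<Rightarrow> ('a \<times> 'a) set \<Rightarrow> bool" where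
  "marg_null M R \<longleftrightarrow> R \<subseteq> space M \<times> space M \<and>
     (\<exists>N\<in>null_sets M. R \<subseteq> (N \<times> space M) \<union> (space M \<times> N))"

definition marg_equiv :: "'a measure \<Rightarrow> ('a \<times> 'a) set \<Rightarrow> ('a \<times> 'a) set \<Rightarrow> bool" where
  "marg_equiv M A B \<longleftrightarrow> marg_null M ((A - B) \<union> (B - A))"

definition mae_eq ::
  "'a measure \<Rightarrow> ('a \<times> 'a \<Rightarrow> complex) \<Rightarrow> ('a \<times> 'a \<Rightarrow> complex) \<Rightarrow> bool" where
  "mae_eq M \<phi> \<psi> \<longleftrightarrow> marg_null M {p \<in> space M \<times> space M. \<phi> p \<noteq> \<psi> p}"

definition omega_open :: "'a measure \<Rightarrow> ('a \<times> 'a) set \<Rightarrow> bool" where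
  "omega_open M E \<longleftrightarrow> E \<subseteq> space M \<times> space M \<and>
     (\<exists>\<alpha> \<beta> :: nat \<Rightarrow> 'a set. range \<alpha> \<subseteq> sets M \<and> range \<beta> \<subseteq> sets M \<and>
        marg_equiv M E (\<Union>n. \<alpha> n \<times> \<beta> n))"

definition omega_closed :: "'a measure \<Rightarrow> ('a \<times> 'a) set \<Rightarrow> bool" where
  "omega_closed M E \<longleftrightarrow> E \<subseteq> space M \<times> space M \<and> omega_open M (space M \<times> space M - E)"


section \<open>Symbols and supports\<close>

definition haagerup_rep ::
  "'a measure \<Rightarrow> ('a l2op \<Rightarrow> 'a l2op) \<Rightarrow> (nat \<Rightarrow> 'a \<Rightarrow> complex) \<Rightarrow> (nat \<Rightarrow> 'a \<Rightarrow> complex) \<Rightarrow> bool"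
where
  "haagerup_rep M \<Phi> f g \<longleftrightarrow>
     (\<forall>n. f n \<in> borel_measurable M \<and> g n \<in> borel_measurable M) \<and>
     (\<forall>s\<in>space M. summable (\<lambda>n. (cmod (f n s))\<^sup>2) \<and> summable (\<lambda>n. (cmod (g n s))\<^sup>2)) \<and>
     (\<exists>C. \<forall>s\<in>space M. (\<Sum>n. (cmod (f n s))\<^sup>2) \<le> C \<and> (\<Sum>n. (cmod (g n s))\<^sup>2) \<le> C) \<and>
     (\<forall>T\<in>BH M. limitin (wstar_topology M)
        (op_sum M (\<lambda>n. op_comp M (mult_op M (f n)) (op_comp M T (mult_op M (g n)))))
        (\<Phi> T) sequentially)"

text \<open>
  The symbol is an equivalence class of functions modulo equality m.a.e.; it does not depend on
  the representation, so the union over all representations below is that class.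
\<close>

definition symbol_class ::
  "'a measure \<Rightarrow> ('a l2op \<Rightarrow> 'a l2op) \<Rightarrow> ('a \<times> 'a \<Rightarrow> complex) set" where
  "symbol_class M \<Phi> =
     {\<phi>. \<exists>f g. haagerup_rep M \<Phi> f g \<and> mae_eq M \<phi> (\<lambda>(s, t). \<Sum>n. f n s * g n t)}"

definition supports :: "'a measure \<Rightarrow> 'a l2op set \<Rightarrow> ('a \<times> 'a) set \<Rightarrow> bool" where
  "supports M \<S> \<Omega> \<longleftrightarrow> (\<forall>\<alpha>\<in>sets M. \<forall>\<beta>\<in>sets M. (\<alpha> \<times> \<beta>) \<inter> \<Omega> = {} \<longrightarrow>
     (\<forall>T\<in>\<S>. op_comp M (proj_op M \<alpha>) (op_comp M T (proj_op M \<beta>)) = op_zero M))"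

definition is_omega_support :: "'a measure \<Rightarrow> 'a l2op set \<Rightarrow> ('a \<times> 'a) set \<Rightarrow> bool" where
  "is_omega_support M \<S> \<Omega> \<longleftrightarrow> omega_closed M \<Omega> \<and> supports M \<S> \<Omega> \<and>
     (\<forall>\<Omega>'. omega_closed M \<Omega>' \<and> supports M \<S> \<Omega>' \<longrightarrow> marg_null M (\<Omega> - \<Omega>'))"

end

theory Submission
  imports Defs
begin

text \<open>
  Write the symbol as \<open>\<phi>(s, t) = \<Sum>n. f n s * g n t\<close>, the pairing of the \<open>\<ell>\<^sup>2\<close>-valued functions
  \<open>s \<mapsto> (f n s)\<close> and \<open>t \<mapsto> (g n t)\<close>. Two facts about this pairing carry the proof.
  
  First, \<open>\<phi>\<close> is nearly constant on suitable rectangles. As \<open>\<ell>\<^sup>2\<close> is separable, the space is covered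
  by countably many measurable sets on which \<open>f\<close> has small \<open>\<ell>\<^sup>2\<close>-oscillation, and likewise for \<open>g\<close>;
  by Cauchy-Schwarz \<open>\<phi>\<close> varies by less than 1 on each product of two such sets. Outside a marginally
  null set \<open>\<phi>\<close> has only the values 0 and 1, so it is constant there on each of these countably many
  rectangles: each one is contained in \<open>A\<close> or disjoint from it
  (\<open>indicator_symbol_blocks\<close>). Hence \<open>A\<close> is \<open>\<omega>\<close>-closed.
  
  Second, the map acts on a rectangle \<open>E \<times> F\<close> on which \<open>\<phi>\<close> is constantly \<open>c\<close> as multiplication by \<open>c\<close>:
  the compressions of \<open>\<Phi> T\<close> and of \<open>c T\<close> to \<open>E \<times> F\<close> agree for every \<open>T\<close>
  (\<open>symbol_constant_compression_AE\<close>). To see this, \<open>\<Phi> T u\<close> is computed pointwise almost everywhere as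
  \<open>\<Sum>n. f n s * (T (g n u)) s\<close> (\<open>haagerup_rep_AE\<close>). With the coefficients fixed at one point \<open>s'\<close> of \<open>E\<close>
  the sum is \<open>T (\<Sum>n. f n s' * g n u) = c T u\<close>; this holds simultaneously for the countably many \<open>s'\<close>
  of an \<open>\<ell>\<^sup>2\<close>-dense subset of \<open>E\<close>, off a single null set, and extends to \<open>s' = s\<close> by continuity
  (\<open>symbol_constant_AE\<close>).
  
  With \<open>c = 0\<close> the second fact says that \<open>A\<close> supports the range of the map. With \<open>c = 1\<close> it gives
  minimality: let \<open>\<Omega>\<close> be an \<open>\<omega>\<close>-closed set supporting the range. Up to a marginally null set,
  \<open>A - \<Omega>\<close> is a countable union of rectangles \<open>E \<times> F\<close> on which \<open>\<phi> = 1\<close> and which do not meet \<open>\<Omega>\<close>. The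
  compression to \<open>E \<times> F\<close> of every operator in the range vanishes, and for the image of the rank-one
  operator from the indicator of \<open>F\<close> to the indicator of \<open>E\<close> this compression is that rank-one operator
  itself. So \<open>E\<close> or \<open>F\<close> is null, and \<open>A - \<Omega>\<close> is marginally null. Thus \<open>A\<close> is itself an \<open>\<omega>\<close>-support,
  and \<open>\<omega>\<close>-supports are unique up to marginally null sets.
\<close>

section \<open>Square-summable sequences\<close>

definition sq_summable :: "(nat \<Rightarrow> complex) \<Rightarrow> bool" where
  "sq_summable a \<longleftrightarrow> summable (\<lambda>n. (cmod (a n))\<^sup>2)"

definition sq_sum :: "(nat \<Rightarrow> complex) \<Rightarrow> real" where
  "sq_sum a = (\<Sum>n. (cmod (a n))\<^sup>2)"

lemma sq_sum_nonneg: "sq_summable a \<Longrightarrow> 0 \<le> sq_sum a"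
  unfolding sq_summable_def sq_sum_def by (intro suminf_nonneg) auto

lemma sum_le_sq_sum: "sq_summable a \<Longrightarrow> (\<Sum>n<m. (cmod (a n))\<^sup>2) \<le> sq_sum a"
  unfolding sq_summable_def sq_sum_def by (intro sum_le_suminf) auto

lemma cmod_add_sq_le: "(cmod (x + y))\<^sup>2 \<le> 2 * (cmod x)\<^sup>2 + 2 * (cmod y)\<^sup>2"
proof -
  have "(cmod (x + y))\<^sup>2 \<le> (cmod x + cmod y)\<^sup>2"
    by (intro power_mono norm_triangle_ineq) auto
  also have "\<dots> \<le> 2 * (cmod x)\<^sup>2 + 2 * (cmod y)\<^sup>2"
    using zero_le_power2[of "cmod x - cmod y"] unfolding power2_sum power2_diff by linarith
  finally show ?thesis .
qed

lemma cmod_diff_sq_le: "(cmod (x - y))\<^sup>2 \<le> 2 * (cmod x)\<^sup>2 + 2 * (cmod y)\<^sup>2"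
  using cmod_add_sq_le[of x "- y"] by simp

lemma sq_summable_diff:
  assumes "sq_summable a" "sq_summable b"
  shows "sq_summable (\<lambda>n. a n - b n)"
    and "sq_sum (\<lambda>n. a n - b n) \<le> 2 * sq_sum a + 2 * sq_sum b"
proof -
  have s: "summable (\<lambda>n. 2 * (cmod (a n))\<^sup>2 + 2 * (cmod (b n))\<^sup>2)"
    using assms unfolding sq_summable_def by (intro summable_add summable_mult) auto
  show d: "sq_summable (\<lambda>n. a n - b n)"
    unfolding sq_summable_def
    by (rule summable_comparison_test'[OF s, of 0]) (use cmod_diff_sq_le in auto)
  have "sq_sum (\<lambda>n. a n - b n) \<le> (\<Sum>n. 2 * (cmod (a n))\<^sup>2 + 2 * (cmod (b n))\<^sup>2)"
    using d s unfolding sq_sum_def sq_summable_def by (intro suminf_le cmod_diff_sq_le)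
  also have "\<dots> = 2 * sq_sum a + 2 * sq_sum b"
    using assms unfolding sq_sum_def sq_summable_def
    by (subst suminf_add[symmetric]) (auto simp: suminf_mult intro: summable_mult)
  finally show "sq_sum (\<lambda>n. a n - b n) \<le> 2 * sq_sum a + 2 * sq_sum b" .
qed

lemma summable_mult_sq_summable:
  assumes "sq_summable a" "sq_summable b"
  shows "summable (\<lambda>n. a n * b n)"
proof -
  have s: "summable (\<lambda>n. (cmod (a n))\<^sup>2 + (cmod (b n))\<^sup>2)"
    using assms unfolding sq_summable_def by (intro summable_add) auto
  have "norm (a n * b n) \<le> (cmod (a n))\<^sup>2 + (cmod (b n))\<^sup>2" for n
  proof -
    have "2 * (cmod (a n) * cmod (b n)) \<le> (cmod (a n))\<^sup>2 + (cmod (b n))\<^sup>2"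
      using sum_squares_bound[of "cmod (a n)" "cmod (b n)"] by simp
    moreover have "0 \<le> cmod (a n) * cmod (b n)" by simp
    ultimately show ?thesis unfolding norm_mult by linarith
  qed
  then show ?thesis by (intro summable_comparison_test'[OF s, of 0]) auto
qed

lemma Cauchy_Schwarz_partial_sum:
  assumes "sq_summable a" "sq_summable b"
  shows "(cmod (\<Sum>n<m. a n * b n))\<^sup>2 \<le> sq_sum a * sq_sum b"
proof -
  have "(cmod (\<Sum>n<m. a n * b n))\<^sup>2 \<le> (\<Sum>n<m. cmod (a n) * cmod (b n))\<^sup>2"
    by (intro power_mono) (auto intro: sum_norm_le simp: norm_mult)
  also have "\<dots> \<le> (\<Sum>n<m. (cmod (a n))\<^sup>2) * (\<Sum>n<m. (cmod (b n))\<^sup>2)"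
    by (rule Cauchy_Schwarz_ineq_sum)
  also have "\<dots> \<le> sq_sum a * sq_sum b"
    using assms by (intro mult_mono sum_le_sq_sum sq_sum_nonneg sum_nonneg) auto
  finally show ?thesis .
qed

lemma Cauchy_Schwarz_suminf:
  assumes "sq_summable a" "sq_summable b"
  shows "(cmod (\<Sum>n. a n * b n))\<^sup>2 \<le> sq_sum a * sq_sum b"
proof -
  have "(\<lambda>m. (cmod (\<Sum>n<m. a n * b n))\<^sup>2) \<longlonglongrightarrow> (cmod (\<Sum>n. a n * b n))\<^sup>2"
    by (intro tendsto_intros summable_LIMSEQ summable_mult_sq_summable assms)
  then show ?thesis
    by (rule LIMSEQ_le_const2) (use Cauchy_Schwarz_partial_sum[OF assms] in auto)
qed

text \<open>
  The finitely supported sequences with entries in a countable dense set of complex numbers are dense: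
  the tail of a square-summable sequence is small, and each of the finitely many remaining entries can
  be approximated.
\<close>

lemma countable_sq_summable_dense:
  "\<exists>D. countable D \<and> (\<forall>c\<in>D. sq_summable c) \<and>
       (\<forall>a e. sq_summable a \<longrightarrow> 0 < e \<longrightarrow> (\<exists>c\<in>D. sq_sum (\<lambda>n. a n - c n) < e))"
proof -
  obtain Q :: "complex set" where Q: "countable Q" "\<And>X. open X \<Longrightarrow> X \<noteq> {} \<Longrightarrow> \<exists>q\<in>Q. q \<in> X"
    using countable_dense_exists by metis
  define c where "c l n = (if n < length l then l ! n else 0)" for l :: "complex list" and n
  have c: "sq_summable (c l)" for l
    unfolding sq_summable_def by (rule summable_finite[of "{..<length l}"]) (auto simp: c_def)
  have "\<exists>l\<in>lists Q. sq_sum (\<lambda>n. a n - c l n) < e" if a: "sq_summable a" and e: "0 < e" for a e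
  proof -
    obtain N where N: "(\<Sum>i. (cmod (a (i + N)))\<^sup>2) < e / 2"
      using suminf_exist_split[of "e/2", OF _ a[unfolded sq_summable_def]] e
      by (metis half_gt_zero norm_le_zero_iff order_refl abs_of_nonneg real_norm_def
          abs_less_iff)
    \<comment> \<open>\<open>N\<close> entries with squared error at most \<open>r\<^sup>2\<close> contribute less than \<open>e / 2\<close>.\<close>
    define r where "r = sqrt (e / (2 * (real N + 1)))"
    have r: "r > 0" "r\<^sup>2 = e / (2 * (real N + 1))" using e unfolding r_def by auto
    have "\<exists>q\<in>Q. q \<in> ball (a n) r" for n using r by (intro Q(2)) auto
    then obtain q where q: "\<And>n. q n \<in> Q" "\<And>n. q n \<in> ball (a n) r" by metis
    define l where "l = map q [0..<N]"
    have "sq_sum (\<lambda>n. a n - c l n) = (\<Sum>i. (cmod (a (i + N) - c l (i + N)))\<^sup>2) + (\<Sum>i<N. (cmod (a i - c l i))\<^sup>2)"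
      unfolding sq_sum_def
      by (rule suminf_split_initial_segment) (use sq_summable_diff(1)[OF a c] in \<open>simp add: sq_summable_def\<close>)
    also have "(\<Sum>i. (cmod (a (i + N) - c l (i + N)))\<^sup>2) = (\<Sum>i. (cmod (a (i + N)))\<^sup>2)"
      by (simp add: c_def l_def)
    also have "(\<Sum>i<N. (cmod (a i - c l i))\<^sup>2) \<le> (\<Sum>i<N. r\<^sup>2)"
    proof (intro sum_mono power_mono)
      fix i assume "i \<in> {..<N}"
      then show "cmod (a i - c l i) \<le> r" using q(2)[of i] by (auto simp: c_def l_def dist_norm)
    qed auto
    also have "\<dots> \<le> e / 2" unfolding r using e by (simp add: field_simps)
    finally have "sq_sum (\<lambda>n. a n - c l n) < e" using N by linarith
    moreover have "l \<in> lists Q" using q by (auto simp: l_def)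
    ultimately show ?thesis by blast
  qed
  then show ?thesis
    using Q(1) c by (intro exI[of _ "c ` lists Q"]) auto
qed

text \<open>
  Subsets of a separable metric space are separable, here for the pullback of the \<open>\<ell>\<^sup>2\<close>-distance along
  \<open>F\<close>. The dense points can be taken in \<open>X\<close> itself, which matters when a property is known
  only at points of \<open>X\<close>.
\<close>

lemma countable_l2_dense_subset:
  assumes "\<And>s. s \<in> X \<Longrightarrow> sq_summable (F s)"
  shows "\<exists>S\<subseteq>X. countable S \<and> (\<forall>s\<in>X. \<forall>e>0. \<exists>s'\<in>S. sq_sum (\<lambda>n. F s n - F s' n) < e)"
proof -
  obtain D where D: "countable D" "\<And>c. c \<in> D \<Longrightarrow> sq_summable c"
    "\<And>a e. sq_summable a \<Longrightarrow> 0 < e \<Longrightarrow> \<exists>c\<in>D. sq_sum (\<lambda>n. a n - c n) < e"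
    using countable_sq_summable_dense by metis
  define near where "near c k s \<longleftrightarrow> s \<in> X \<and> sq_sum (\<lambda>n. F s n - c n) < 1 / real (Suc k)" for c k s
  define S where "S = (\<lambda>(c, k). SOME s. near c k s) ` {p \<in> D \<times> UNIV. \<exists>s. near (fst p) (snd p) s}"
  have near: "near c k (SOME s. near c k s)" if "near c k s" for c k s
    using that by (rule someI)
  have "countable {p \<in> D \<times> (UNIV :: nat set). \<exists>s. near (fst p) (snd p) s}"
    by (rule countable_subset[of _ "D \<times> UNIV"]) (use D(1) in auto)
  then have "countable S" unfolding S_def by (rule countable_image)
  moreover have "S \<subseteq> X" using near by (auto simp: S_def near_def)
  moreover have "\<exists>s'\<in>S. sq_sum (\<lambda>n. F s n - F s' n) < e" if s: "s \<in> X" and e: "e > 0" for s e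
  proof -
    obtain k where k: "1 / real (Suc k) < e / 4" using nat_approx_posE[of "e/4"] e by auto
    obtain c where c: "c \<in> D" "sq_sum (\<lambda>n. F s n - c n) < 1 / real (Suc k)"
      using D(3)[OF assms[OF s], of "1 / real (Suc k)"] by auto
    define s' where "s' = (SOME s. near c k s)"
    have n: "near c k s" using c s by (simp add: near_def)
    have s': "s' \<in> S" unfolding S_def s'_def using n c(1) by (auto intro!: image_eqI[of _ _ "(c, k)"])
    have n': "near c k s'" unfolding s'_def by (rule near[OF n])
    have "sq_sum (\<lambda>n. F s n - F s' n) = sq_sum (\<lambda>n. (F s n - c n) - (F s' n - c n))" by simp
    also have "\<dots> \<le> 2 * sq_sum (\<lambda>n. F s n - c n) + 2 * sq_sum (\<lambda>n. F s' n - c n)"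
      by (intro sq_summable_diff assms s D(2) c(1)) (use n' in \<open>simp add: near_def\<close>)
    also have "\<dots> < e" using n n' k unfolding near_def by linarith
    finally show ?thesis using s' by blast
  qed
  ultimately show ?thesis by blast
qed

section \<open>Square-integrable functions and operators acting on them\<close>

definition sq_int :: "'a measure \<Rightarrow> ('a \<Rightarrow> complex) \<Rightarrow> real" where
  "sq_int M h = (LINT x|M. (cmod (h x))\<^sup>2)"

lemma sq_int_nonneg: "0 \<le> sq_int M h"
  by (simp add: sq_int_def)

lemma sq_integrableD:
  assumes "h \<in> sq_integrable M"
  shows "h \<in> borel_measurable M" and "integrable M (\<lambda>x. (cmod (h x))\<^sup>2)"
  using assms by (auto simp: sq_integrable_def)

lemma sq_integrable_dominated:
  assumes "h \<in> borel_measurable M" and "integrable M W"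
    and "AE x in M. (cmod (h x))\<^sup>2 \<le> W x"
  shows "h \<in> sq_integrable M"
proof -
  have "integrable M (\<lambda>x. (cmod (h x))\<^sup>2)"
    by (rule Bochner_Integration.integrable_bound[OF assms(2)]) (use assms(1,3) in auto)
  then show ?thesis using assms(1) by (simp add: sq_integrable_def)
qed

lemma sq_integrable_add:
  assumes "h \<in> sq_integrable M" "k \<in> sq_integrable M"
  shows "(\<lambda>x. h x + k x) \<in> sq_integrable M"
proof (rule sq_integrable_dominated)
  show "integrable M (\<lambda>x. 2 * (cmod (h x))\<^sup>2 + 2 * (cmod (k x))\<^sup>2)"
    using sq_integrableD(2)[OF assms(1)] sq_integrableD(2)[OF assms(2)] by simp
qed (use assms cmod_add_sq_le in \<open>auto dest!: sq_integrableD(1)\<close>)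

lemma sq_integrable_mult_bounded:
  assumes "h \<in> sq_integrable M" "f \<in> borel_measurable M" "\<And>x. x \<in> space M \<Longrightarrow> (cmod (f x))\<^sup>2 \<le> K"
  shows "(\<lambda>x. f x * h x) \<in> sq_integrable M"
proof (rule sq_integrable_dominated)
  show "integrable M (\<lambda>x. K * (cmod (h x))\<^sup>2)" using sq_integrableD(2)[OF assms(1)] by simp
  show "AE x in M. (cmod (f x * h x))\<^sup>2 \<le> K * (cmod (h x))\<^sup>2"
    using assms(3) by (auto simp: norm_mult power_mult_distrib intro!: mult_right_mono)
qed (use assms sq_integrableD(1)[OF assms(1)] in auto)

lemma sq_integrable_scale: "h \<in> sq_integrable M \<Longrightarrow> (\<lambda>x. c * h x) \<in> sq_integrable M"
  by (rule sq_integrable_mult_bounded[where K="(cmod c)\<^sup>2"]) auto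

lemma sq_integrable_diff:
  assumes "h \<in> sq_integrable M" "k \<in> sq_integrable M"
  shows "(\<lambda>x. h x - k x) \<in> sq_integrable M"
  using sq_integrable_add[OF assms(1) sq_integrable_scale[OF assms(2), of "- 1"]] by simp

lemma sq_integrable_zero: "(\<lambda>x. 0) \<in> sq_integrable M"
  by (simp add: sq_integrable_def)

lemma sq_integrable_sum:
  "(\<And>n. n < m \<Longrightarrow> h n \<in> sq_integrable M) \<Longrightarrow> (\<lambda>x. \<Sum>n<(m::nat). h n x) \<in> sq_integrable M"
  by (induction m) (auto intro: sq_integrable_zero sq_integrable_add)

lemma sq_integrable_indicator:
  assumes "h \<in> sq_integrable M" "E \<in> sets M"
  shows "(\<lambda>x. indicator E x * h x) \<in> sq_integrable M"
  by (rule sq_integrable_mult_bounded[where K=1]) (use assms in \<open>auto simp: indicator_def\<close>)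

lemma integrable_mult_cnj:
  assumes "h \<in> sq_integrable M" "k \<in> sq_integrable M"
  shows "integrable M (\<lambda>x. h x * cnj (k x))"
proof (rule Bochner_Integration.integrable_bound)
  show "integrable M (\<lambda>x. (cmod (h x))\<^sup>2 + (cmod (k x))\<^sup>2)"
    using assms by (auto dest: sq_integrableD)
  have "norm (h x * cnj (k x)) \<le> norm ((cmod (h x))\<^sup>2 + (cmod (k x))\<^sup>2)" for x
  proof -
    have "2 * (cmod (h x) * cmod (k x)) \<le> (cmod (h x))\<^sup>2 + (cmod (k x))\<^sup>2"
      using sum_squares_bound[of "cmod (h x)" "cmod (k x)"] by simp
    moreover have "0 \<le> cmod (h x) * cmod (k x)" by simp
    ultimately have "cmod (h x) * cmod (k x) \<le> (cmod (h x))\<^sup>2 + (cmod (k x))\<^sup>2" by linarith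
    then show ?thesis by (simp add: norm_mult)
  qed
  then show "AE x in M. norm (h x * cnj (k x)) \<le> norm ((cmod (h x))\<^sup>2 + (cmod (k x))\<^sup>2)" by simp
  have "cnj \<in> borel_measurable borel"
    by (intro borel_measurable_continuous_onI continuous_intros)
  from measurable_compose[OF sq_integrableD(1)[OF assms(2)] this]
  show "(\<lambda>x. h x * cnj (k x)) \<in> borel_measurable M"
    using sq_integrableD(1)[OF assms(1)] by (intro borel_measurable_times)
qed

lemma sq_int_eq_0_iff:
  assumes "h \<in> sq_integrable M"
  shows "sq_int M h = 0 \<longleftrightarrow> (AE x in M. h x = 0)"
  unfolding sq_int_def using sq_integrableD(2)[OF assms]
  by (subst integral_nonneg_eq_0_iff_AE) auto

text \<open>
  Test against \<open>v = h - k\<close>.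
\<close>

lemma AE_eq_if_all_inner_eq:
  assumes "h \<in> sq_integrable M" "k \<in> sq_integrable M"
    and "\<And>v. v \<in> sq_integrable M \<Longrightarrow> (LINT x|M. h x * cnj (v x)) = (LINT x|M. k x * cnj (v x))"
  shows "AE x in M. h x = k x"
proof -
  define d where "d x = h x - k x" for x
  have d: "d \<in> sq_integrable M" unfolding d_def using assms(1,2) by (rule sq_integrable_diff)
  have "complex_of_real (sq_int M d) = (LINT x|M. d x * cnj (d x))"
    unfolding sq_int_def integral_complex_of_real[symmetric]
    by (intro Bochner_Integration.integral_cong refl) (simp add: complex_norm_square del: of_real_power)
  also have "\<dots> = (LINT x|M. h x * cnj (d x)) - (LINT x|M. k x * cnj (d x))"
    using Bochner_Integration.integral_diff[OF integrable_mult_cnj[OF assms(1) d]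
        integrable_mult_cnj[OF assms(2) d]]
    by (simp add: d_def left_diff_distrib)
  also have "\<dots> = 0" using assms(3)[OF d] by simp
  finally have "sq_int M d = 0" by simp
  then show ?thesis using sq_int_eq_0_iff[OF d] by (simp add: d_def)
qed

lemma equiv_ae_rel: "equiv (sq_integrable M) (ae_rel M)"
proof (rule equivI)
  show "refl_on (sq_integrable M) (ae_rel M)" by (auto simp: refl_on_def ae_rel_def)
  show "sym (ae_rel M)" unfolding sym_def ae_rel_def by auto
  show "trans (ae_rel M)" unfolding trans_def ae_rel_def by auto
qed (auto simp: ae_rel_def)

lemma L2_class_in_L2: "h \<in> sq_integrable M \<Longrightarrow> L2_class M h \<in> L2 M"
  unfolding L2_class_def L2_def by (rule quotientI)

lemma L2_class_eq_iff:
  assumes "h \<in> sq_integrable M" "k \<in> sq_integrable M"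
  shows "L2_class M h = L2_class M k \<longleftrightarrow> (AE x in M. h x = k x)"
proof -
  have "L2_class M h = L2_class M k \<longleftrightarrow> (h, k) \<in> ae_rel M"
    unfolding L2_class_def using eq_equiv_class_iff[OF equiv_ae_rel assms] .
  also have "\<dots> \<longleftrightarrow> (AE x in M. h x = k x)" using assms by (simp add: ae_rel_def)
  finally show ?thesis .
qed

lemma L2_rep:
  assumes "u \<in> L2 M"
  shows "L2_rep u \<in> sq_integrable M" and "L2_class M (L2_rep u) = u"
proof -
  obtain h where h: "h \<in> sq_integrable M" "u = L2_class M h"
    using assms unfolding L2_def L2_class_def quotient_def by blast
  have "(h, h) \<in> ae_rel M" using h(1) by (simp add: ae_rel_def)
  then have "h \<in> u" unfolding h(2) L2_class_def by blast
  then have "L2_rep u \<in> u" unfolding L2_rep_def by (rule someI[of "\<lambda>f. f \<in> u"])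
  then have r: "(h, L2_rep u) \<in> ae_rel M" using h(2) unfolding L2_class_def by blast
  then show r': "L2_rep u \<in> sq_integrable M" by (simp add: ae_rel_def)
  have "AE x in M. L2_rep u x = h x" using r by (auto simp: ae_rel_def)
  then show "L2_class M (L2_rep u) = u"
    using L2_class_eq_iff[OF r' h(1)] h(2) by blast
qed

lemma L2_rep_L2_class:
  assumes "h \<in> sq_integrable M"
  shows "AE x in M. L2_rep (L2_class M h) x = h x"
proof -
  note u = L2_class_in_L2[OF assms]
  show ?thesis using L2_class_eq_iff[OF L2_rep(1)[OF u] assms] L2_rep(2)[OF u] by blast
qed

text \<open>
  The action of an operator on functions rather than on classes. It depends only on the class of the
  argument, but its value is one chosen representative, so linearity holds almost everywhere only.
\<close>

definition op_fun :: "'a measure \<Rightarrow> 'a l2op \<Rightarrow> ('a \<Rightarrow> complex) \<Rightarrow> 'a \<Rightarrow> complex" where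
  "op_fun M T h = L2_rep (T (L2_class M h))"

lemma BH_in_L2: "T \<in> BH M \<Longrightarrow> u \<in> L2 M \<Longrightarrow> T u \<in> L2 M"
  unfolding BH_def mem_Collect_eq by (drule conjunct1) (rule PiE_mem)

lemma op_fun_in: "T \<in> BH M \<Longrightarrow> h \<in> sq_integrable M \<Longrightarrow> op_fun M T h \<in> sq_integrable M"
  unfolding op_fun_def by (rule L2_rep(1)[OF BH_in_L2[OF _ L2_class_in_L2]])

lemma op_fun_cong:
  assumes "h \<in> sq_integrable M" "k \<in> sq_integrable M" "AE x in M. h x = k x"
  shows "op_fun M T h = op_fun M T k"
  using L2_class_eq_iff[OF assms(1,2)] assms(3) by (simp add: op_fun_def)

lemma L2_add_class:
  assumes "h \<in> sq_integrable M" "k \<in> sq_integrable M"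
  shows "L2_add M (L2_class M h) (L2_class M k) = L2_class M (\<lambda>x. h x + k x)"
  unfolding L2_add_def
  by (subst L2_class_eq_iff)
     (use L2_rep_L2_class[OF assms(1)] L2_rep_L2_class[OF assms(2)] in
       \<open>auto intro!: sq_integrable_add L2_rep(1) L2_class_in_L2 assms\<close>)

lemma L2_scale_class:
  assumes "h \<in> sq_integrable M"
  shows "L2_scale M c (L2_class M h) = L2_class M (\<lambda>x. c * h x)"
  unfolding L2_scale_def
  by (subst L2_class_eq_iff)
     (use L2_rep_L2_class[OF assms(1)] in
       \<open>auto intro!: sq_integrable_scale L2_rep(1) L2_class_in_L2 assms\<close>)

lemma BH_add: "T \<in> BH M \<Longrightarrow> u \<in> L2 M \<Longrightarrow> v \<in> L2 M \<Longrightarrow> T (L2_add M u v) = L2_add M (T u) (T v)"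
  and BH_scale: "T \<in> BH M \<Longrightarrow> u \<in> L2 M \<Longrightarrow> T (L2_scale M c u) = L2_scale M c (T u)"
  and BH_bounded: "T \<in> BH M \<Longrightarrow> \<exists>C. \<forall>u\<in>L2 M. L2_norm M (T u) \<le> C * L2_norm M u"
  unfolding BH_def by simp_all

lemma op_fun_add:
  assumes T: "T \<in> BH M" and h: "h \<in> sq_integrable M" and k: "k \<in> sq_integrable M"
  shows "AE x in M. op_fun M T (\<lambda>x. h x + k x) x = op_fun M T h x + op_fun M T k x"
proof -
  have "T (L2_class M (\<lambda>x. h x + k x)) = L2_class M (\<lambda>x. op_fun M T h x + op_fun M T k x)"
    using BH_add[OF T L2_class_in_L2[OF h] L2_class_in_L2[OF k]]
    unfolding L2_add_class[OF h k] unfolding op_fun_def L2_add_def .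
  then show ?thesis
    using L2_rep_L2_class[OF sq_integrable_add[OF op_fun_in[OF T h] op_fun_in[OF T k]]]
    unfolding op_fun_def by metis
qed

lemma op_fun_scale:
  assumes T: "T \<in> BH M" and h: "h \<in> sq_integrable M"
  shows "AE x in M. op_fun M T (\<lambda>x. c * h x) x = c * op_fun M T h x"
proof -
  have "T (L2_class M (\<lambda>x. c * h x)) = L2_class M (\<lambda>x. c * op_fun M T h x)"
    using BH_scale[OF T L2_class_in_L2[OF h], of c]
    unfolding L2_scale_class[OF h] unfolding op_fun_def L2_scale_def .
  then show ?thesis
    using L2_rep_L2_class[OF sq_integrable_scale[OF op_fun_in[OF T h]]]
    unfolding op_fun_def by metis
qed

lemma op_fun_linear_combination:
  assumes T: "T \<in> BH M" and h: "\<And>n. h n \<in> sq_integrable M"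
  shows "AE x in M. op_fun M T (\<lambda>x. \<Sum>n<(m::nat). a n * h n x) x = (\<Sum>n<m. a n * op_fun M T (h n) x)"
proof (induction m)
  case 0
  show ?case using op_fun_scale[OF T sq_integrable_zero, of 0] by simp
next
  case (Suc m)
  have "(\<lambda>x. \<Sum>n<m. a n * h n x) \<in> sq_integrable M" "(\<lambda>x. a m * h m x) \<in> sq_integrable M"
    by (intro sq_integrable_sum sq_integrable_scale h)+
  from op_fun_add[OF T this] op_fun_scale[OF T h, of "a m" m] Suc
  show ?case by auto
qed

lemma op_fun_bound:
  assumes T: "T \<in> BH M"
  obtains K where "0 \<le> K" "\<And>h. h \<in> sq_integrable M \<Longrightarrow> sq_int M (op_fun M T h) \<le> K * sq_int M h"
proof -
  obtain C where C: "\<And>u. u \<in> L2 M \<Longrightarrow> L2_norm M (T u) \<le> C * L2_norm M u"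
    using BH_bounded[OF T] by blast
  have le: "sq_int M (op_fun M T h) \<le> C\<^sup>2 * sq_int M h" if h: "h \<in> sq_integrable M" for h
  proof -
    have n: "sq_int M (L2_rep (L2_class M h)) = sq_int M h"
      unfolding sq_int_def using L2_rep_L2_class[OF h] h L2_rep(1)[OF L2_class_in_L2[OF h]]
      by (intro integral_cong_AE) (auto dest: sq_integrableD)
    have "sqrt (sq_int M (op_fun M T h)) \<le> C * sqrt (sq_int M h)"
      using C[OF L2_class_in_L2[OF h]] n
      unfolding L2_norm_def op_fun_def sq_int_def[symmetric] by metis
    then have "(sqrt (sq_int M (op_fun M T h)))\<^sup>2 \<le> (C * sqrt (sq_int M h))\<^sup>2"
      by (intro power_mono) (auto simp: sq_int_nonneg)
    then show ?thesis by (simp add: power_mult_distrib sq_int_nonneg)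
  qed
  show thesis by (rule that[of "C\<^sup>2"]) (use le in auto)
qed

section \<open>Families of functions with uniformly square-summable values\<close>

text \<open>
  Monotone convergence: the pointwise sum has finite integral, so it is finite almost everywhere.
\<close>

lemma AE_summable_suminf_integrable:
  fixes f :: "nat \<Rightarrow> 'a \<Rightarrow> real"
  assumes f: "\<And>n. integrable M (f n)" "\<And>n x. 0 \<le> f n x"
    and bound: "\<And>m. (\<Sum>n<m. LINT x|M. f n x) \<le> B"
  shows "AE x in M. summable (\<lambda>n. f n x)" and "integrable M (\<lambda>x. \<Sum>n. f n x)"
proof -
  have s: "summable (\<lambda>n. LINT x|M. f n x)"
    by (rule summableI_nonneg_bounded[OF _ bound]) (simp add: f(2))
  have "(\<integral>\<^sup>+x. (\<Sum>n. ennreal (f n x)) \<partial>M) = (\<Sum>n. \<integral>\<^sup>+x. ennreal (f n x) \<partial>M)"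
    using f(1) by (intro nn_integral_suminf) auto
  also have "\<dots> = (\<Sum>n. ennreal (LINT x|M. f n x))"
    using f by (intro suminf_cong nn_integral_eq_integral) auto
  also have "\<dots> \<noteq> \<infinity>" using s f(2) by (simp add: suminf_ennreal2)
  finally have "AE x in M. (\<Sum>n. ennreal (f n x)) \<noteq> \<infinity>"
    using f(1) by (intro nn_integral_PInf_AE) auto
  then show a: "AE x in M. summable (\<lambda>n. f n x)"
    by eventually_elim (use f(2) in \<open>auto intro: summable_suminf_not_top\<close>)
  show "integrable M (\<lambda>x. \<Sum>n. f n x)"
    using f s a by (intro integrable_suminf) auto
qed

text \<open>
  A bounded measurable function from the space to \<open>\<ell>\<^sup>2\<close>, given by its coordinates; \<open>C\<close> bounds the square of
  its norm.
\<close>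

definition bounded_l2_family :: "'a measure \<Rightarrow> real \<Rightarrow> (nat \<Rightarrow> 'a \<Rightarrow> complex) \<Rightarrow> bool" where
  "bounded_l2_family M C f \<longleftrightarrow> (\<forall>n. f n \<in> borel_measurable M) \<and>
     (\<forall>s\<in>space M. sq_summable (\<lambda>n. f n s) \<and> sq_sum (\<lambda>n. f n s) \<le> C)"

lemma bounded_l2_familyD:
  assumes "bounded_l2_family M C f"
  shows "f n \<in> borel_measurable M"
    and "s \<in> space M \<Longrightarrow> sq_summable (\<lambda>n. f n s)"
    and "s \<in> space M \<Longrightarrow> sq_sum (\<lambda>n. f n s) \<le> C"
    and "s \<in> space M \<Longrightarrow> (cmod (f n s))\<^sup>2 \<le> C"
proof -
  show 1: "f n \<in> borel_measurable M" "s \<in> space M \<Longrightarrow> sq_summable (\<lambda>n. f n s)"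
    "s \<in> space M \<Longrightarrow> sq_sum (\<lambda>n. f n s) \<le> C"
    using assms unfolding bounded_l2_family_def by auto
  assume s: "s \<in> space M"
  have "(cmod (f n s))\<^sup>2 \<le> (\<Sum>i<Suc n. (cmod (f i s))\<^sup>2)" by (simp add: sum_nonneg)
  also have "\<dots> \<le> C" using sum_le_sq_sum[OF 1(2)[OF s], of "Suc n"] 1(3)[OF s] by linarith
  finally show "(cmod (f n s))\<^sup>2 \<le> C" .
qed

lemma sq_integrable_mult_family:
  assumes "bounded_l2_family M C f" "h \<in> sq_integrable M"
  shows "(\<lambda>x. f n x * h x) \<in> sq_integrable M"
  using assms(2) bounded_l2_familyD(1)[OF assms(1)] bounded_l2_familyD(4)[OF assms(1)]
  by (rule sq_integrable_mult_bounded)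

text \<open>
  The squared norms of the vectors \<open>g n u\<close> add up to at most \<open>C\<close> times the squared norm of \<open>u\<close>, and a
  bounded operator preserves such a bound up to a factor. Hence the images under \<open>T\<close> have
  square-summable values at almost every point.
\<close>

lemma op_fun_family_AE_summable:
  assumes T: "T \<in> BH M" and g: "bounded_l2_family M C g" and u: "u \<in> sq_integrable M"
  defines "w \<equiv> \<lambda>n. op_fun M T (\<lambda>x. g n x * u x)"
  shows "AE s in M. sq_summable (\<lambda>n. w n s)" and "integrable M (\<lambda>s. sq_sum (\<lambda>n. w n s))"
proof -
  obtain K where K: "0 \<le> K" "\<And>h. h \<in> sq_integrable M \<Longrightarrow> sq_int M (op_fun M T h) \<le> K * sq_int M h"
    using op_fun_bound[OF T] by blast
  note gu = sq_integrable_mult_family[OF g u]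
  have w: "w n \<in> sq_integrable M" for n unfolding w_def by (rule op_fun_in[OF T gu])
  have "(\<Sum>n<m. sq_int M (w n)) \<le> K * (C * sq_int M u)" for m
  proof -
    have "(\<Sum>n<m. sq_int M (w n)) \<le> (\<Sum>n<m. K * sq_int M (\<lambda>x. g n x * u x))"
      unfolding w_def by (intro sum_mono K(2) gu)
    also have "\<dots> = K * (LINT x|M. (\<Sum>n<m. (cmod (g n x * u x))\<^sup>2))"
      unfolding sq_int_def sum_distrib_left[symmetric]
      by (subst Bochner_Integration.integral_sum) (use sq_integrableD(2)[OF gu] in auto)
    also have "(LINT x|M. (\<Sum>n<m. (cmod (g n x * u x))\<^sup>2)) \<le> (LINT x|M. C * (cmod (u x))\<^sup>2)"
    proof (rule integral_mono)
      fix x assume x: "x \<in> space M"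
      have "(\<Sum>n<m. (cmod (g n x * u x))\<^sup>2) = (\<Sum>n<m. (cmod (g n x))\<^sup>2) * (cmod (u x))\<^sup>2"
        by (simp add: norm_mult power_mult_distrib sum_distrib_right)
      also have "\<dots> \<le> C * (cmod (u x))\<^sup>2"
        using sum_le_sq_sum[OF bounded_l2_familyD(2)[OF g x], of m] bounded_l2_familyD(3)[OF g x]
        by (intro mult_right_mono) auto
      finally show "(\<Sum>n<m. (cmod (g n x * u x))\<^sup>2) \<le> C * (cmod (u x))\<^sup>2" .
    qed (use sq_integrableD(2)[OF gu] sq_integrableD(2)[OF u] in auto)
    finally show ?thesis using K(1) by (simp add: sq_int_def mult_left_mono)
  qed
  then have b: "(\<Sum>n<m. LINT x|M. (cmod (w n x))\<^sup>2) \<le> K * (C * sq_int M u)" for m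
    by (simp add: sq_int_def)
  show "AE s in M. sq_summable (\<lambda>n. w n s)" "integrable M (\<lambda>s. sq_sum (\<lambda>n. w n s))"
    unfolding sq_summable_def sq_sum_def
    using AE_summable_suminf_integrable[OF sq_integrableD(2)[OF w] _ b] by auto
qed

text \<open>
  The sum is \<open>T\<close> applied to \<open>\<Sum>n. f n s' * g n u = c u\<close>, except that \<open>s'\<close> has to be replaced by the point
  \<open>s\<close> at which the result is evaluated. This diagonal substitution is not meaningful for a single
  \<open>s'\<close>, as each identity holds only almost everywhere. It becomes so by taking all \<open>s'\<close> in a
  countable subset of \<open>E\<close> that is dense for the \<open>\<ell>\<^sup>2\<close>-distance of the coefficients.
\<close>

lemma symbol_constant_AE:
  assumes T: "T \<in> BH M"
    and f: "bounded_l2_family M C f" and g: "bounded_l2_family M C g"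
    and u: "u \<in> sq_integrable M"
    and E: "E \<subseteq> space M" and F: "\<And>t. t \<in> space M \<Longrightarrow> t \<notin> F \<Longrightarrow> u t = 0"
    and const: "\<And>s t. s \<in> E \<Longrightarrow> t \<in> F \<Longrightarrow> t \<in> space M \<Longrightarrow> (\<Sum>n. f n s * g n t) = c"
  shows "AE s in M. s \<in> E \<longrightarrow>
           (\<Sum>n. f n s * op_fun M T (\<lambda>t. g n t * u t) s) = c * op_fun M T u s"
proof -
  define w where "w n = op_fun M T (\<lambda>x. g n x * u x)" for n
  note gu = sq_integrable_mult_family[OF g u]
  have w_summable: "AE s in M. sq_summable (\<lambda>n. w n s)"
    unfolding w_def by (rule op_fun_family_AE_summable(1)[OF T g u])
  obtain K where K: "0 \<le> K" "\<And>h. h \<in> sq_integrable M \<Longrightarrow> sq_int M (op_fun M T h) \<le> K * sq_int M h"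
    using op_fun_bound[OF T] by blast
  \<comment> \<open>The coefficients are fixed at a point \<open>s\<close> of \<open>E\<close>; \<open>q m\<close> is the error of the \<open>m\<close>-th partial sum.\<close>
  have fixed_coefficients: "AE x in M. (\<Sum>n. f n s * w n x) = c * op_fun M T u x" if s: "s \<in> E" for s
  proof -
    have sX: "s \<in> space M" using s E by auto
    define q where "q m x = (\<Sum>n<m. f n s * (g n x * u x)) + (- c) * u x" for m :: nat and x
    have q: "q m \<in> sq_integrable M" for m
      unfolding q_def by (intro sq_integrable_add sq_integrable_sum sq_integrable_scale gu u)
    have q_eq: "q m x = (\<Sum>n<m. f n s * g n x) * u x - c * u x" for m x
      by (simp add: q_def sum_distrib_right mult.assoc)
    have "(\<lambda>m. sq_int M (q m)) \<longlonglongrightarrow> (LINT x|M. 0 :: real)"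
      unfolding sq_int_def
    proof (rule integral_dominated_convergence)
      show "integrable M (\<lambda>x. (2 * (C * C) + 2 * (cmod c)\<^sup>2) * (cmod (u x))\<^sup>2)"
        using sq_integrableD(2)[OF u] by simp
      show "AE x in M. (\<lambda>m. (cmod (q m x))\<^sup>2) \<longlonglongrightarrow> 0"
      proof (rule AE_I2)
        fix x assume x: "x \<in> space M"
        have "(\<lambda>m. q m x) \<longlonglongrightarrow> 0"
        proof (cases "x \<in> F")
          case True
          have "(\<lambda>m. (\<Sum>n<m. f n s * g n x) * u x - c * u x) \<longlonglongrightarrow> c * u x - c * u x"
            unfolding const[OF s True x, symmetric]
            by (intro tendsto_intros summable_LIMSEQ summable_mult_sq_summable
                bounded_l2_familyD(2)[OF f sX] bounded_l2_familyD(2)[OF g x])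
          then show ?thesis by (simp add: q_eq)
        qed (simp add: q_eq F[OF x])
        then have "(\<lambda>m. (cmod (q m x))\<^sup>2) \<longlonglongrightarrow> (cmod 0)\<^sup>2" by (intro tendsto_intros)
        then show "(\<lambda>m. (cmod (q m x))\<^sup>2) \<longlonglongrightarrow> 0" by simp
      qed
      fix m
      show "AE x in M. norm ((cmod (q m x))\<^sup>2) \<le> (2 * (C * C) + 2 * (cmod c)\<^sup>2) * (cmod (u x))\<^sup>2"
      proof (rule AE_I2)
        fix x assume x: "x \<in> space M"
        have C: "0 \<le> C"
          using sq_sum_nonneg[OF bounded_l2_familyD(2)[OF f sX]] bounded_l2_familyD(3)[OF f sX]
          by linarith
        have "(cmod (\<Sum>n<m. f n s * g n x))\<^sup>2 \<le> C * C"
          by (rule order_trans[OF Cauchy_Schwarz_partial_sum])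
             (intro mult_mono C sq_sum_nonneg bounded_l2_familyD(2,3)[OF f sX]
               bounded_l2_familyD(2,3)[OF g x])+
        then have "2 * (cmod ((\<Sum>n<m. f n s * g n x) * u x))\<^sup>2 + 2 * (cmod (c * u x))\<^sup>2
            \<le> 2 * (C * C * (cmod (u x))\<^sup>2) + 2 * ((cmod c)\<^sup>2 * (cmod (u x))\<^sup>2)"
          by (simp add: norm_mult power_mult_distrib mult_right_mono)
        then show "norm ((cmod (q m x))\<^sup>2) \<le> (2 * (C * C) + 2 * (cmod c)\<^sup>2) * (cmod (u x))\<^sup>2"
          using cmod_diff_sq_le[of "(\<Sum>n<m. f n s * g n x) * u x" "c * u x"]
          by (simp add: q_eq algebra_simps)
      qed
      show "(\<lambda>x. (cmod (q m x))\<^sup>2) \<in> borel_measurable M"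
        using sq_integrableD(1)[OF q] by measurable
    qed auto
    then have lim: "(\<lambda>m. K * sq_int M (q m)) \<longlonglongrightarrow> 0"
      using tendsto_mult_left[of _ "0::real" sequentially K] by simp
    have "(\<lambda>m. sq_int M (op_fun M T (q m))) \<longlonglongrightarrow> 0"
      by (rule tendsto_sandwich[OF _ _ tendsto_const lim]) (auto simp: sq_int_nonneg K(2)[OF q])
    then have "\<exists>r. strict_mono r \<and> (AE x in M. (\<lambda>m. (cmod (op_fun M T (q (r m)) x))\<^sup>2) \<longlonglongrightarrow> 0)"
      using sq_integrableD(2)[OF op_fun_in[OF T q]]
      by (intro tendsto_L1_AE_subseq) (auto simp: sq_int_def)
    then obtain r where r: "strict_mono r"
      "AE x in M. (\<lambda>m. (cmod (op_fun M T (q (r m)) x))\<^sup>2) \<longlonglongrightarrow> 0" by blast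
    have lin: "AE x in M. op_fun M T (q m) x = (\<Sum>n<m. f n s * w n x) - c * op_fun M T u x" for m
    proof -
      have "(\<lambda>x. \<Sum>n<m. f n s * (g n x * u x)) \<in> sq_integrable M" "(\<lambda>x. (- c) * u x) \<in> sq_integrable M"
        by (intro sq_integrable_sum sq_integrable_scale gu u)+
      from op_fun_add[OF T this] op_fun_linear_combination[OF T gu, where a = "\<lambda>n. f n s" and m = m]
        op_fun_scale[OF T u, of "- c"]
      show ?thesis
        unfolding q_def w_def by eventually_elim simp
    qed
    then have "AE x in M. \<forall>m. op_fun M T (q m) x = (\<Sum>n<m. f n s * w n x) - c * op_fun M T u x"
      unfolding AE_all_countable by blast
    with r(2) w_summable show ?thesis
    proof eventually_elim
      case (elim x)
      have "(\<lambda>m. (cmod ((\<Sum>n<m. f n s * w n x) - c * op_fun M T u x))\<^sup>2)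
          \<longlonglongrightarrow> (cmod ((\<Sum>n. f n s * w n x) - c * op_fun M T u x))\<^sup>2"
        by (intro tendsto_intros summable_LIMSEQ summable_mult_sq_summable elim(2)
            bounded_l2_familyD(2)[OF f sX])
      from LIMSEQ_subseq_LIMSEQ[OF this r(1)]
      have "(\<lambda>m. (cmod (op_fun M T (q (r m)) x))\<^sup>2)
          \<longlonglongrightarrow> (cmod ((\<Sum>n. f n s * w n x) - c * op_fun M T u x))\<^sup>2"
        by (simp add: elim(3) o_def)
      from LIMSEQ_unique[OF this elim(1)] show ?case by simp
    qed
  qed
  have "sq_summable (\<lambda>n. f n s)" if "s \<in> E" for s
    using that E bounded_l2_familyD(2)[OF f] by blast
  then obtain S where S: "S \<subseteq> E" "countable S"
    "\<And>s e. s \<in> E \<Longrightarrow> 0 < e \<Longrightarrow> \<exists>s'\<in>S. sq_sum (\<lambda>n. f n s - f n s') < e"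
    using countable_l2_dense_subset[of E "\<lambda>s n. f n s"] by blast
  have "AE x in M. \<forall>s\<in>S. (\<Sum>n. f n s * w n x) = c * op_fun M T u x"
    using S(1) fixed_coefficients by (subst AE_ball_countable[OF S(2)]) blast
  with w_summable show ?thesis
    unfolding w_def[symmetric]
  proof eventually_elim
    case (elim x)
    show ?case
    proof
      assume x: "x \<in> E"
      define d where "d = (\<Sum>n. f n x * w n x) - c * op_fun M T u x"
      have W: "0 \<le> sq_sum (\<lambda>n. w n x)" by (rule sq_sum_nonneg[OF elim(1)])
      have "(cmod d)\<^sup>2 \<le> 0 + e" if e: "0 < e" for e
      proof -
        define e' where "e' = e / (sq_sum (\<lambda>n. w n x) + 1)"
        have e': "0 < e'" using e W by (simp add: e'_def)
        obtain s where s: "s \<in> S" "sq_sum (\<lambda>n. f n x - f n s) < e'"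
          using S(3)[OF x e'] by blast
        have fx: "sq_summable (\<lambda>n. f n x)" and fs: "sq_summable (\<lambda>n. f n s)"
          using x s(1) S(1) E bounded_l2_familyD(2)[OF f] by blast+
        have "d = (\<Sum>n. f n x * w n x) - (\<Sum>n. f n s * w n x)"
          using elim(2) s(1) by (simp add: d_def)
        also have "\<dots> = (\<Sum>n. (f n x - f n s) * w n x)"
          using summable_mult_sq_summable[OF fx elim(1)] summable_mult_sq_summable[OF fs elim(1)]
          by (simp add: suminf_diff left_diff_distrib)
        finally have "(cmod d)\<^sup>2 \<le> sq_sum (\<lambda>n. f n x - f n s) * sq_sum (\<lambda>n. w n x)"
          using Cauchy_Schwarz_suminf[OF sq_summable_diff(1)[OF fx fs] elim(1)] by simp
        also have "\<dots> \<le> e' * (sq_sum (\<lambda>n. w n x) + 1)"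
          using s(2) W e' by (intro mult_mono) auto
        also have "\<dots> = e" using W by (simp add: e'_def)
        finally show ?thesis by simp
      qed
      then have "(cmod d)\<^sup>2 \<le> 0" by (rule field_le_epsilon)
      then show "(\<Sum>n. f n x * w n x) = c * op_fun M T u x" by (simp add: d_def)
    qed
  qed
qed

section \<open>Pointwise form of a Haagerup representation\<close>

lemma L2_inner_class:
  assumes "h \<in> sq_integrable M" "k \<in> sq_integrable M"
  shows "L2_inner M (L2_class M h) (L2_class M k) = (LINT x|M. h x * cnj (k x))"
  unfolding L2_inner_def
proof (rule integral_cong_AE)
  show "AE x in M. L2_rep (L2_class M h) x * cnj (L2_rep (L2_class M k) x) = h x * cnj (k x)"
    using L2_rep_L2_class[OF assms(1)] L2_rep_L2_class[OF assms(2)] by eventually_elim simp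
qed (intro borel_measurable_integrable integrable_mult_cnj assms L2_rep(1) L2_class_in_L2)+

lemma L2_inner_add_left:
  assumes "u \<in> L2 M" "v \<in> L2 M" "w \<in> L2 M"
  shows "L2_inner M (L2_add M u v) w = L2_inner M u w + L2_inner M v w"
proof -
  have "L2_inner M (L2_add M u v) w = (LINT x|M. (L2_rep u x + L2_rep v x) * cnj (L2_rep w x))"
    unfolding L2_add_def
    using L2_inner_class[OF sq_integrable_add[OF L2_rep(1)[OF assms(1)] L2_rep(1)[OF assms(2)]] L2_rep(1)[OF assms(3)]]
    by (simp add: L2_rep(2)[OF assms(3)])
  also have "\<dots> = L2_inner M u w + L2_inner M v w"
    unfolding L2_inner_def distrib_right
    by (intro Bochner_Integration.integral_add integrable_mult_cnj L2_rep(1) assms)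
  finally show ?thesis .
qed

lemma L2_add_in_L2: "u \<in> L2 M \<Longrightarrow> v \<in> L2 M \<Longrightarrow> L2_add M u v \<in> L2 M"
  unfolding L2_add_def by (intro L2_class_in_L2 sq_integrable_add L2_rep(1))

lemma L2_zero_in_L2: "L2_zero M \<in> L2 M"
  unfolding L2_zero_def by (intro L2_class_in_L2 sq_integrable_zero)

lemma L2_rep_zero: "AE x in M. L2_rep (L2_zero M) x = 0"
  unfolding L2_zero_def by (rule L2_rep_L2_class[OF sq_integrable_zero])

lemma L2_inner_zero: "L2_inner M u (L2_zero M) = 0" "L2_inner M (L2_zero M) u = 0"
  unfolding L2_inner_def
  by (rule integral_eq_zero_AE, use L2_rep_zero in eventually_elim, simp)+

lemma L2_inner_op_sum:
  assumes "\<And>n. S n u \<in> L2 M" "u \<in> L2 M" "v \<in> L2 M"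
  shows "L2_inner M (op_sum M S m u) v = (\<Sum>n<m. L2_inner M (S n u) v)"
proof -
  have L2: "op_sum M S m u \<in> L2 M" for m
    by (induction m) (auto simp: op_zero_def op_add_def assms L2_zero_in_L2 L2_add_in_L2)
  show ?thesis
    by (induction m) (simp_all add: op_zero_def op_add_def assms L2_inner_zero L2_inner_add_left L2)
qed

text \<open>
  The weak* topology is finer than the weak operator topology: the pairing of \<open>T u\<close> with \<open>v\<close> is one of
  the functionals generating it, given by sequences that vanish from index 1 on.
\<close>

lemma limitin_wstar_inner:
  assumes lim: "limitin (wstar_topology M) S L sequentially" and u: "u \<in> L2 M" and v: "v \<in> L2 M"
  shows "(\<lambda>n. L2_inner M (S n u) v) \<longlonglongrightarrow> L2_inner M (L u) v"
proof (rule topological_tendstoI)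
  define single where "single w = (\<lambda>n::nat. if n = 0 then w else L2_zero M)" for w
  have l2: "l2_seq M (single w)" if w: "w \<in> L2 M" for w
  proof -
    have "L2_norm M (L2_zero M) = 0"
      unfolding L2_norm_def using L2_rep_zero[of M]
      by (subst integral_eq_zero_AE) (auto elim: eventually_mono)
    then have "summable (\<lambda>n. (L2_norm M (single w n))\<^sup>2)"
      by (intro summable_finite[of "{0}"]) (auto simp: single_def)
    then show ?thesis using w L2_zero_in_L2 by (auto simp: l2_seq_def single_def)
  qed
  have functional: "(\<Sum>n. L2_inner M (T (single u n)) (single v n)) = L2_inner M (T u) v" for T
    by (subst suminf_finite[of "{0}"]) (auto simp: single_def L2_inner_zero)
  fix U assume U: "open U" "L2_inner M (L u) v \<in> U"
  define W where "W = {T \<in> BH M. (\<Sum>n. L2_inner M (T (single u n)) (single v n)) \<in> U}"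
  have "openin (wstar_topology M) W"
    unfolding wstar_topology_def W_def
    using l2[OF u] l2[OF v] U(1) by (intro topology_generated_by_Basis) blast
  moreover have "L \<in> W"
  proof -
    have "L \<in> topspace (wstar_topology M)" using lim by (simp add: limitin_def)
    then have "L \<in> BH M" unfolding wstar_topology_def topology_generated_by_topspace by blast
    then show ?thesis using U(2) by (simp add: W_def functional)
  qed
  ultimately have "\<forall>\<^sub>F n in sequentially. S n \<in> W" using lim by (simp add: limitin_def)
  then show "\<forall>\<^sub>F n in sequentially. L2_inner M (S n u) v \<in> U"
    by eventually_elim (simp add: W_def functional)
qed

lemma mult_op_class:
  assumes h: "h \<in> sq_integrable M" and f: "f \<in> borel_measurable M"
    "\<And>x. x \<in> space M \<Longrightarrow> (cmod (f x))\<^sup>2 \<le> K"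
  shows "mult_op M f (L2_class M h) = L2_class M (\<lambda>x. f x * h x)"
proof -
  note u = L2_class_in_L2[OF h]
  have "L2_class M (\<lambda>x. f x * L2_rep (L2_class M h) x) = L2_class M (\<lambda>x. f x * h x)"
    using L2_class_eq_iff[OF sq_integrable_mult_bounded[OF L2_rep(1)[OF u] f]
        sq_integrable_mult_bounded[OF h f]] L2_rep_L2_class[OF h] by auto
  then show ?thesis using u by (simp add: mult_op_def)
qed

lemma sandwich_class:
  assumes T: "T \<in> BH M" and h: "h \<in> sq_integrable M"
    and f: "f \<in> borel_measurable M" "\<And>x. x \<in> space M \<Longrightarrow> (cmod (f x))\<^sup>2 \<le> K"
    and g: "g \<in> borel_measurable M" "\<And>x. x \<in> space M \<Longrightarrow> (cmod (g x))\<^sup>2 \<le> K"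
  shows "op_comp M (mult_op M f) (op_comp M T (mult_op M g)) (L2_class M h) =
         L2_class M (\<lambda>x. f x * op_fun M T (\<lambda>x. g x * h x) x)"
proof -
  have gh: "(\<lambda>x. g x * h x) \<in> sq_integrable M" by (rule sq_integrable_mult_bounded[OF h g])
  have "T (L2_class M (\<lambda>x. g x * h x)) = L2_class M (op_fun M T (\<lambda>x. g x * h x))"
    unfolding op_fun_def by (rule L2_rep(2)[OF BH_in_L2[OF T L2_class_in_L2[OF gh]], symmetric])
  then show ?thesis
    using L2_class_in_L2[OF h]
    by (simp add: op_comp_def compose_def mult_op_class[OF h g] mult_op_class[OF op_fun_in[OF T gh] f])
qed

lemma haagerup_rep_bounded_l2_family:
  assumes "haagerup_rep M \<Phi> f g"
  obtains C where "bounded_l2_family M C f" "bounded_l2_family M C g"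
proof -
  obtain C where "\<forall>s\<in>space M. (\<Sum>n. (cmod (f n s))\<^sup>2) \<le> C \<and> (\<Sum>n. (cmod (g n s))\<^sup>2) \<le> C"
    using assms unfolding haagerup_rep_def by blast
  then have "bounded_l2_family M C f" "bounded_l2_family M C g"
    using assms unfolding haagerup_rep_def bounded_l2_family_def sq_summable_def sq_sum_def by blast+
  then show thesis by (rule that)
qed

text \<open>
  The weak* convergence gives convergence of the partial sums in the weak sense, whereas by
  Cauchy-Schwarz they also converge pointwise almost everywhere, dominated by a square-integrable
  function. The two limits have the same inner products with all \<open>v\<close>, so they coincide.
\<close>

lemma haagerup_rep_AE:
  assumes rep: "haagerup_rep M \<Phi> f g" and T: "T \<in> BH M" and \<Phi>T: "\<Phi> T \<in> BH M"
    and u: "u \<in> sq_integrable M"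
  shows "AE s in M. op_fun M (\<Phi> T) u s = (\<Sum>n. f n s * op_fun M T (\<lambda>t. g n t * u t) s)"
proof -
  obtain C where f: "bounded_l2_family M C f" and g: "bounded_l2_family M C g"
    using haagerup_rep_bounded_l2_family[OF rep] .
  define w where "w n = op_fun M T (\<lambda>x. g n x * u x)" for n
  define W where "W s = sq_sum (\<lambda>n. w n s)" for s
  define d where "d s = (\<Sum>n. f n s * w n s)" for s
  have w: "w n \<in> sq_integrable M" for n
    unfolding w_def by (rule op_fun_in[OF T sq_integrable_mult_family[OF g u]])
  note fw = sq_integrable_mult_family[OF f w]
  have w_summable: "AE s in M. sq_summable (\<lambda>n. w n s)" and W: "integrable M W"
    unfolding w_def W_def by (rule op_fun_family_AE_summable[OF T g u])+
  have bound: "AE s in M. (cmod (\<Sum>n<m. f n s * w n s))\<^sup>2 \<le> C * W s" for m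
    using w_summable AE_space
  proof eventually_elim
    case (elim s)
    show ?case
      using Cauchy_Schwarz_partial_sum[OF bounded_l2_familyD(2)[OF f elim(2)] elim(1), of m]
        mult_right_mono[OF bounded_l2_familyD(3)[OF f elim(2)] sq_sum_nonneg[OF elim(1)]]
      unfolding W_def by linarith
  qed
  have lim: "AE s in M. (\<lambda>m. \<Sum>n<m. f n s * w n s) \<longlonglongrightarrow> d s"
    using w_summable AE_space
  proof eventually_elim
    case (elim s)
    then show ?case unfolding d_def
      by (intro summable_LIMSEQ summable_mult_sq_summable bounded_l2_familyD(2)[OF f])
  qed
  have d_meas: "d \<in> borel_measurable M"
    unfolding d_def using fw by (intro borel_measurable_suminf) (auto dest: sq_integrableD)
  have d: "d \<in> sq_integrable M"
  proof (rule sq_integrable_dominated[OF d_meas])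
    show "integrable M (\<lambda>s. C * W s)" using W by simp
    have "AE s in M. \<forall>m. (cmod (\<Sum>n<m. f n s * w n s))\<^sup>2 \<le> C * W s"
      using bound by (simp add: AE_all_countable)
    with lim show "AE s in M. (cmod (d s))\<^sup>2 \<le> C * W s"
    proof eventually_elim
      case (elim s)
      have "(\<lambda>m. (cmod (\<Sum>n<m. f n s * w n s))\<^sup>2) \<longlonglongrightarrow> (cmod (d s))\<^sup>2"
        by (intro tendsto_intros elim(1))
      then show ?case by (rule LIMSEQ_le_const2) (use elim(2) in auto)
    qed
  qed
  show ?thesis
    unfolding w_def[symmetric] d_def[symmetric]
  proof (rule AE_eq_if_all_inner_eq[OF op_fun_in[OF \<Phi>T u] d])
    fix v assume v: "v \<in> sq_integrable M"
    define S where "S n = op_comp M (mult_op M (f n)) (op_comp M T (mult_op M (g n)))" for n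
    have S: "S n (L2_class M u) = L2_class M (\<lambda>x. f n x * w n x)" for n
      unfolding S_def w_def
      by (rule sandwich_class[OF T u bounded_l2_familyD(1)[OF f] bounded_l2_familyD(4)[OF f]
            bounded_l2_familyD(1)[OF g] bounded_l2_familyD(4)[OF g]])
    have "limitin (wstar_topology M) (op_sum M S) (\<Phi> T) sequentially"
      using rep T unfolding haagerup_rep_def S_def[abs_def] by blast
    from limitin_wstar_inner[OF this L2_class_in_L2[OF u] L2_class_in_L2[OF v]]
    have "(\<lambda>m. \<Sum>n<m. L2_inner M (S n (L2_class M u)) (L2_class M v))
      \<longlonglongrightarrow> L2_inner M (\<Phi> T (L2_class M u)) (L2_class M v)"
      by (subst (asm) L2_inner_op_sum) (simp_all add: S L2_class_in_L2 fw u v)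
    moreover have "L2_inner M (\<Phi> T (L2_class M u)) (L2_class M v) =
        (LINT x|M. op_fun M (\<Phi> T) u x * cnj (v x))"
      using L2_inner_class[OF op_fun_in[OF \<Phi>T u] v]
      by (simp add: op_fun_def L2_rep(2)[OF BH_in_L2[OF \<Phi>T L2_class_in_L2[OF u]]])
    moreover have "(\<Sum>n<m. L2_inner M (S n (L2_class M u)) (L2_class M v)) =
        (LINT x|M. (\<Sum>n<m. f n x * w n x) * cnj (v x))" for m
      unfolding S L2_inner_class[OF fw v] sum_distrib_right
      by (rule Bochner_Integration.integral_sum[symmetric]) (rule integrable_mult_cnj[OF fw v])
    ultimately have "(\<lambda>m. LINT x|M. (\<Sum>n<m. f n x * w n x) * cnj (v x))
        \<longlonglongrightarrow> (LINT x|M. op_fun M (\<Phi> T) u x * cnj (v x))"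
      by simp
    moreover have "(\<lambda>m. LINT x|M. (\<Sum>n<m. f n x * w n x) * cnj (v x)) \<longlonglongrightarrow> (LINT x|M. d x * cnj (v x))"
    proof (rule integral_dominated_convergence)
      show "integrable M (\<lambda>x. C * W x + (cmod (v x))\<^sup>2)"
        using W sq_integrableD(2)[OF v] by simp
      show "AE x in M. (\<lambda>m. (\<Sum>n<m. f n x * w n x) * cnj (v x)) \<longlonglongrightarrow> d x * cnj (v x)"
        using lim by eventually_elim (intro tendsto_intros)
      fix m
      show "AE x in M. norm ((\<Sum>n<m. f n x * w n x) * cnj (v x)) \<le> C * W x + (cmod (v x))\<^sup>2"
        using bound[of m]
      proof eventually_elim
        case (elim x)
        let ?a = "cmod (\<Sum>n<m. f n x * w n x)"
        have "2 * (?a * cmod (v x)) \<le> ?a\<^sup>2 + (cmod (v x))\<^sup>2"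
          using sum_squares_bound[of ?a "cmod (v x)"] by simp
        moreover have "0 \<le> ?a * cmod (v x)" by simp
        ultimately show ?case using elim unfolding norm_mult complex_mod_cnj by linarith
      qed
    qed (intro borel_measurable_integrable integrable_mult_cnj d v sq_integrable_sum fw)+
    ultimately show "(LINT x|M. op_fun M (\<Phi> T) u x * cnj (v x)) = (LINT x|M. d x * cnj (v x))"
      by (rule LIMSEQ_unique)
  qed
qed

section \<open>Rectangles on which the symbol is constant\<close>

lemma symbol_constant_compression_AE:
  assumes rep: "haagerup_rep M \<Phi> f g" and T: "T \<in> BH M" and \<Phi>T: "\<Phi> T \<in> BH M"
    and u: "u \<in> sq_integrable M"
    and "E \<subseteq> space M" and "\<And>t. t \<in> space M \<Longrightarrow> t \<notin> F \<Longrightarrow> u t = 0"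
    and "\<And>s t. s \<in> E \<Longrightarrow> t \<in> F \<Longrightarrow> t \<in> space M \<Longrightarrow> (\<Sum>n. f n s * g n t) = c"
  shows "AE s in M. s \<in> E \<longrightarrow> op_fun M (\<Phi> T) u s = c * op_fun M T u s"
proof -
  obtain C where f: "bounded_l2_family M C f" and g: "bounded_l2_family M C g"
    using haagerup_rep_bounded_l2_family[OF rep] .
  have "AE s in M. s \<in> E \<longrightarrow>
      (\<Sum>n. f n s * op_fun M T (\<lambda>t. g n t * u t) s) = c * op_fun M T u s"
    by (rule symbol_constant_AE[OF T f g u assms(5), where F = F and c = c]) (fact assms(6,7))+
  then show ?thesis
    using haagerup_rep_AE[of M \<Phi> f g T u, OF rep T \<Phi>T u] by eventually_elim auto
qed

lemma small_l2_cover: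
  assumes f: "bounded_l2_family M C f" and e: "0 < e"
  obtains \<B> where "countable \<B>" "\<B> \<subseteq> sets M" "\<Union>\<B> = space M"
    "\<And>B s s'. B \<in> \<B> \<Longrightarrow> s \<in> B \<Longrightarrow> s' \<in> B \<Longrightarrow> sq_sum (\<lambda>n. f n s - f n s') < e"
proof -
  obtain S where S: "S \<subseteq> space M" "countable S"
    "\<And>s d. s \<in> space M \<Longrightarrow> 0 < d \<Longrightarrow> \<exists>s'\<in>S. sq_sum (\<lambda>n. f n s - f n s') < d"
    using countable_l2_dense_subset[of "space M" "\<lambda>s n. f n s"] bounded_l2_familyD(2)[OF f] by blast
  \<comment> \<open>Radius \<open>e / 4\<close>, as the squared distance satisfies the triangle inequality only up to a factor 2.\<close>
  define ball where "ball s = {s' \<in> space M. sq_sum (\<lambda>n. f n s' - f n s) < e / 4}" for s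
  show thesis
  proof (rule that[of "ball ` S"])
    show "countable (ball ` S)" using S(2) by simp
    have [measurable]: "f n \<in> borel_measurable M" for n by (rule bounded_l2_familyD(1)[OF f])
    show "ball ` S \<subseteq> sets M" unfolding ball_def sq_sum_def by auto
    show "\<Union>(ball ` S) = space M" using S(3)[of _ "e / 4"] e by (auto simp: ball_def)
    fix B s s' assume "B \<in> ball ` S" and s: "s \<in> B" "s' \<in> B"
    then obtain r where r: "r \<in> S" "B = ball r" by blast
    have sum: "sq_summable (\<lambda>n. f n x)" if "x \<in> space M" for x
      by (rule bounded_l2_familyD(2)[OF f that])
    have sr: "s \<in> space M" "s' \<in> space M" "r \<in> space M" using s r S(1) by (auto simp: ball_def)
    have "sq_sum (\<lambda>n. (f n s - f n r) - (f n s' - f n r)) \<le>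
        2 * sq_sum (\<lambda>n. f n s - f n r) + 2 * sq_sum (\<lambda>n. f n s' - f n r)"
      by (intro sq_summable_diff sum sr)
    moreover have "sq_sum (\<lambda>n. f n s - f n r) < e / 4" "sq_sum (\<lambda>n. f n s' - f n r) < e / 4"
      using s by (auto simp: r ball_def)
    ultimately show "sq_sum (\<lambda>n. f n s - f n s') < e" by simp
  qed
qed

text \<open>
  Change one argument at a time. Each of the two differences has squared modulus at most
  \<open>C / (4 (C + 1)) < (1/2)\<^sup>2\<close>.
\<close>

lemma symbol_oscillation_small:
  assumes f: "bounded_l2_family M C f" and g: "bounded_l2_family M C g" and C: "0 \<le> C"
    and s: "s \<in> space M" "s' \<in> space M" and t: "t \<in> space M" "t' \<in> space M"
    and fs: "sq_sum (\<lambda>n. f n s - f n s') < 1 / (4 * (C + 1))"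
    and gt: "sq_sum (\<lambda>n. g n t - g n t') < 1 / (4 * (C + 1))"
  shows "cmod ((\<Sum>n. f n s * g n t) - (\<Sum>n. f n s' * g n t')) < 1"
proof -
  note F = bounded_l2_familyD(2)[OF f] and G = bounded_l2_familyD(2)[OF g]
  have half: "cmod (\<Sum>n. a n * b n) < 1 / 2"
    if "sq_summable a" "sq_summable b" "sq_sum a < 1 / (4 * (C + 1))" "sq_sum b \<le> C" for a b
  proof -
    have "(cmod (\<Sum>n. a n * b n))\<^sup>2 \<le> sq_sum a * sq_sum b"
      using Cauchy_Schwarz_suminf[OF that(1,2)] .
    also have "\<dots> \<le> 1 / (4 * (C + 1)) * C"
      using that sq_sum_nonneg C by (intro mult_mono) auto
    also have "\<dots> < (1 / 2)\<^sup>2" using C by (simp add: field_simps power2_eq_square)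
    finally show ?thesis by (rule power2_less_imp_less) simp
  qed
  have "(\<Sum>n. f n s * g n t) - (\<Sum>n. f n s' * g n t') =
      (\<Sum>n. (f n s - f n s') * g n t) + (\<Sum>n. (g n t - g n t') * f n s')"
    using summable_mult_sq_summable[OF F[OF s(1)] G[OF t(1)]]
      summable_mult_sq_summable[OF F[OF s(2)] G[OF t(1)]]
      summable_mult_sq_summable[OF F[OF s(2)] G[OF t(2)]]
    by (simp add: left_diff_distrib suminf_diff[symmetric] mult.commute[of "g _ _"])
  moreover have "cmod (\<Sum>n. (f n s - f n s') * g n t) < 1 / 2"
    by (intro half sq_summable_diff F G s t fs bounded_l2_familyD(3)[OF g])
  moreover have "cmod (\<Sum>n. (g n t - g n t') * f n s') < 1 / 2"
    by (intro half sq_summable_diff F G s t gt bounded_l2_familyD(3)[OF f])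
  ultimately show ?thesis
    using norm_triangle_ineq[of "\<Sum>n. (f n s - f n s') * g n t" "\<Sum>n. (g n t - g n t') * f n s'"] by simp
qed

text \<open>
  An indicator function that varies by less than 1 on a set is constant there. The exceptional set \<open>N\<close>
  is removed from the sides of all rectangles, so that the alternative is exact.
\<close>

lemma indicator_symbol_blocks:
  assumes f: "bounded_l2_family M C f" and g: "bounded_l2_family M C g"
    and N: "N \<in> sets M"
    and eq: "\<And>s t. s \<in> space M - N \<Longrightarrow> t \<in> space M - N \<Longrightarrow>
               (\<Sum>n. f n s * g n t) = indicator A (s, t)"
  obtains \<R> where "countable \<R>" "\<R> \<subseteq> sets M \<times> sets M"
    "(\<Union>(B, D)\<in>\<R>. B \<times> D) = (space M - N) \<times> (space M - N)"
    "\<And>B D. (B, D) \<in> \<R> \<Longrightarrow> B \<times> D \<subseteq> A \<or> B \<times> D \<inter> A = {}"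
proof (cases "space M = {}")
  case True
  then show thesis by (intro that[of "{}"]) auto
next
  case False
  then obtain x where x: "x \<in> space M" by blast
  have C: "0 \<le> C"
    using sq_sum_nonneg[OF bounded_l2_familyD(2)[OF f x]] bounded_l2_familyD(3)[OF f x] by linarith
  define e where "e = 1 / (4 * (C + 1))"
  have e: "0 < e" using C by (simp add: e_def)
  obtain \<B> where B: "countable \<B>" "\<B> \<subseteq> sets M" "\<Union>\<B> = space M"
    "\<And>B s s'. B \<in> \<B> \<Longrightarrow> s \<in> B \<Longrightarrow> s' \<in> B \<Longrightarrow> sq_sum (\<lambda>n. f n s - f n s') < e"
    using small_l2_cover[OF f e] by blast
  obtain \<D> where D: "countable \<D>" "\<D> \<subseteq> sets M" "\<Union>\<D> = space M"
    "\<And>B s s'. B \<in> \<D> \<Longrightarrow> s \<in> B \<Longrightarrow> s' \<in> B \<Longrightarrow> sq_sum (\<lambda>n. g n s - g n s') < e"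
    using small_l2_cover[OF g e] by blast
  define \<R> where "\<R> = (\<lambda>(B, D). (B - N, D - N)) ` (\<B> \<times> \<D>)"
  show thesis
  proof (rule that[of \<R>])
    show "countable \<R>" using B(1) D(1) by (simp add: \<R>_def)
    show "\<R> \<subseteq> sets M \<times> sets M" using B(2) D(2) N by (auto simp: \<R>_def)
    show "(\<Union>(B, D)\<in>\<R>. B \<times> D) = (space M - N) \<times> (space M - N)"
      unfolding B(3)[symmetric] \<R>_def using D(3) B(3) by fastforce
  next
    fix B' D' assume "(B', D') \<in> \<R>"
    then obtain B D where BD: "B \<in> \<B>" "D \<in> \<D>" "B' = B - N" "D' = D - N" by (auto simp: \<R>_def)
    have "(s, t) \<in> A \<longleftrightarrow> (s', t') \<in> A" if "s \<in> B'" "s' \<in> B'" "t \<in> D'" "t' \<in> D'" for s s' t t'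
    proof -
      have st: "s \<in> space M - N" "s' \<in> space M - N" "t \<in> space M - N" "t' \<in> space M - N"
        using that BD B(3) D(3) by auto
      have "cmod (indicator A (s, t) - indicator A (s', t')) < 1"
        using symbol_oscillation_small[OF f g C, of s s' t t'] B(4)[OF BD(1), of s s']
          D(4)[OF BD(2), of t t'] that BD st eq[OF st(1,3)] eq[OF st(2,4)]
        by (simp add: e_def)
      then show ?thesis by (cases "(s, t) \<in> A"; cases "(s', t') \<in> A") auto
    qed
    then show "B' \<times> D' \<subseteq> A \<or> B' \<times> D' \<inter> A = {}" by blast
  qed
qed

section \<open>Rank-one operators between indicator functions\<close>

text \<open>
  The variance-like integral of \<open>(t - cmod u)\<^sup>2\<close> is nonnegative for every real \<open>t\<close>. Adding 1 to
  the total mass avoids a division by zero when the measure vanishes.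
\<close>

lemma (in finite_measure) integral_cmod_sq_le:
  assumes u: "u \<in> sq_integrable M"
  shows "integrable M u"
    and "(LINT x|M. cmod (u x))\<^sup>2 \<le> (measure M (space M) + 1) * sq_int M u"
proof -
  note [measurable] = sq_integrableD(1)[OF u]
  show i: "integrable M u"
  proof (rule Bochner_Integration.integrable_bound)
    show "integrable M (\<lambda>x. 1 + (cmod (u x))\<^sup>2)" using sq_integrableD(2)[OF u] by simp
    have "cmod (u x) \<le> 1 + (cmod (u x))\<^sup>2" for x
      using sum_squares_bound[of 1 "cmod (u x)"] norm_ge_zero[of "u x"] by (simp del: norm_ge_zero)
    then show "AE x in M. norm (u x) \<le> norm (1 + (cmod (u x))\<^sup>2)" by simp
  qed simp
  define m where "m = (LINT x|M. cmod (u x))"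
  define a where "a = measure M (space M) + 1"
  have a: "a > 0" "measure M (space M) \<le> a" unfolding a_def by (auto simp: add_nonneg_pos)
  \<comment> \<open>This value minimises \<open>t\<^sup>2 * a - 2 * t * m\<close>.\<close>
  define t where "t = m / a"
  have "0 \<le> (LINT x|M. (t - cmod (u x))\<^sup>2)" by simp
  also have "\<dots> = (LINT x|M. t\<^sup>2 - 2 * t * cmod (u x) + (cmod (u x))\<^sup>2)"
    by (simp add: power2_diff algebra_simps)
  also have "\<dots> = t\<^sup>2 * measure M (space M) - 2 * t * m + sq_int M u"
    using i sq_integrableD(2)[OF u] by (simp add: m_def sq_int_def)
  also have "\<dots> \<le> t\<^sup>2 * a - 2 * t * m + sq_int M u"
    using a(2) by (simp add: mult_left_mono)
  also have "\<dots> = sq_int M u - m\<^sup>2 / a"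
    using a(1) by (simp add: t_def field_simps power2_eq_square)
  finally have "m\<^sup>2 \<le> a * sq_int M u" using a(1) by (simp add: field_simps)
  then show "(LINT x|M. cmod (u x))\<^sup>2 \<le> (measure M (space M) + 1) * sq_int M u"
    by (simp add: m_def a_def)
qed

lemma (in finite_measure) sq_integrable_indicator_one: "E \<in> sets M \<Longrightarrow> indicator E \<in> sq_integrable M"
  unfolding sq_integrable_def
  by (auto intro!: integrable_const_bound[where B = 1] simp: indicator_def)

text \<open>
  In bra-ket notation \<open>|1\<^sub>E\<rangle>\<langle>1\<^sub>F|\<close>: it sends \<open>u\<close> to the integral of \<open>u\<close> over \<open>F\<close> times the indicator function
  of \<open>E\<close>.
\<close>

definition rank_one :: "'a measure \<Rightarrow> 'a set \<Rightarrow> 'a set \<Rightarrow> 'a l2op" where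
  "rank_one M E F =
     (\<lambda>u\<in>L2 M. L2_class M (\<lambda>x. (LINT y|M. indicator F y * L2_rep u y) * indicator E x))"

lemma (in finite_measure) rank_one_class:
  assumes E: "E \<in> sets M" and F: "F \<in> sets M" and h: "h \<in> sq_integrable M"
  shows "rank_one M E F (L2_class M h) =
           L2_class M (\<lambda>x. (LINT y|M. indicator F y * h y) * indicator E x)"
proof -
  note u = L2_class_in_L2[OF h]
  have "(LINT y|M. indicator F y * L2_rep (L2_class M h) y) = (LINT y|M. indicator F y * h y)"
    using L2_rep_L2_class[OF h] sq_integrableD(1)[OF sq_integrable_indicator[OF h F]]
      sq_integrableD(1)[OF sq_integrable_indicator[OF L2_rep(1)[OF u] F]]
    by (intro integral_cong_AE) auto
  then show ?thesis using u by (simp add: rank_one_def)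
qed

lemma (in finite_measure) rank_one_in_BH:
  assumes E: "E \<in> sets M" and F: "F \<in> sets M"
  shows "rank_one M E F \<in> BH M"
proof -
  define I where "I h = (LINT y|M. indicator F y * h y)" for h :: "'a \<Rightarrow> complex"
  note E1 = sq_integrable_scale[OF sq_integrable_indicator_one[OF E]]
  have int: "integrable M (\<lambda>y. indicator F y * h y)" if "h \<in> sq_integrable M" for h :: "'a \<Rightarrow> complex"
    by (rule integral_cmod_sq_le(1)[OF sq_integrable_indicator[OF that F]])
  have R: "rank_one M E F (L2_class M h) = L2_class M (\<lambda>x. I h * indicator E x)"
    if "h \<in> sq_integrable M" for h
    unfolding I_def by (rule rank_one_class[OF E F that])
  have ext: "rank_one M E F \<in> L2 M \<rightarrow>\<^sub>E L2 M"
    unfolding rank_one_def by (intro restrict_PiE_iff[THEN iffD2] ballI L2_class_in_L2 E1)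
  have add: "rank_one M E F (L2_add M u v) = L2_add M (rank_one M E F u) (rank_one M E F v)"
    if u: "u \<in> L2 M" and v: "v \<in> L2 M" for u v
  proof -
    note h = L2_rep(1)[OF u] and k = L2_rep(1)[OF v]
    have "I (\<lambda>x. L2_rep u x + L2_rep v x) = I (L2_rep u) + I (L2_rep v)"
      unfolding I_def using int[OF h] int[OF k] by (simp add: distrib_left)
    then have "rank_one M E F (L2_add M (L2_class M (L2_rep u)) (L2_class M (L2_rep v))) =
        L2_add M (rank_one M E F (L2_class M (L2_rep u))) (rank_one M E F (L2_class M (L2_rep v)))"
      unfolding L2_add_class[OF h k] R[OF sq_integrable_add[OF h k]] R[OF h] R[OF k] L2_add_class[OF E1 E1]
      by (simp add: distrib_right)
    then show ?thesis unfolding L2_rep(2)[OF u] L2_rep(2)[OF v] .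
  qed
  have scale: "rank_one M E F (L2_scale M c u) = L2_scale M c (rank_one M E F u)"
    if u: "u \<in> L2 M" for c u
  proof -
    note h = L2_rep(1)[OF u]
    have "I (\<lambda>x. c * L2_rep u x) = c * I (L2_rep u)"
      unfolding I_def by (simp add: mult.left_commute[of _ c])
    then have "rank_one M E F (L2_scale M c (L2_class M (L2_rep u))) =
        L2_scale M c (rank_one M E F (L2_class M (L2_rep u)))"
      unfolding L2_scale_class[OF h] R[OF sq_integrable_scale[OF h]] R[OF h] L2_scale_class[OF E1]
      by (simp add: mult.assoc)
    then show ?thesis unfolding L2_rep(2)[OF u] .
  qed
  define a where "a = measure M (space M) + 1"
  have a: "0 \<le> a" by (simp add: a_def)
  have bound: "L2_norm M (rank_one M E F u) \<le> a * L2_norm M u" if u: "u \<in> L2 M" for u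
  proof -
    define h where "h = L2_rep u"
    have h: "h \<in> sq_integrable M" unfolding h_def by (rule L2_rep(1)[OF u])
    have norm_class: "L2_norm M (L2_class M k) = sqrt (sq_int M k)" if k: "k \<in> sq_integrable M" for k
      unfolding L2_norm_def sq_int_def
      using L2_rep_L2_class[OF k] sq_integrableD(1)[OF k] sq_integrableD(1)[OF L2_rep(1)[OF L2_class_in_L2[OF k]]]
      by (intro arg_cong[of _ _ sqrt] integral_cong_AE) auto
    have "sq_int M (\<lambda>x. I h * indicator E x) = (LINT x|M. (cmod (I h))\<^sup>2 * indicator E x)"
      unfolding sq_int_def by (intro Bochner_Integration.integral_cong refl) (auto simp: indicator_def)
    also have "\<dots> = (cmod (I h))\<^sup>2 * measure M E" using E by simp
    also have "\<dots> \<le> (cmod (I h))\<^sup>2 * a"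
      using finite_measure_mono[OF sets.sets_into_space[OF E]] by (intro mult_left_mono) (auto simp: a_def)
    also have "(cmod (I h))\<^sup>2 \<le> (LINT x|M. cmod (h x))\<^sup>2"
    proof (rule power_mono)
      have "cmod (I h) \<le> (LINT x|M. cmod (indicator F x * h x))" unfolding I_def by simp
      also have "\<dots> \<le> (LINT x|M. cmod (h x))"
        using int[OF h] integral_cmod_sq_le(1)[OF h]
        by (intro integral_mono integrable_norm) (auto simp: indicator_def)
      finally show "cmod (I h) \<le> (LINT x|M. cmod (h x))" .
    qed simp
    also have "\<dots> \<le> a * sq_int M h" unfolding a_def by (rule integral_cmod_sq_le(2)[OF h])
    finally have "sq_int M (\<lambda>x. I h * indicator E x) \<le> a\<^sup>2 * sq_int M h"
      using a by (simp add: mult_right_mono power2_eq_square mult.commute mult.left_commute)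
    then have "sqrt (sq_int M (\<lambda>x. I h * indicator E x)) \<le> sqrt (a\<^sup>2 * sq_int M h)" by simp
    also have "\<dots> = a * sqrt (sq_int M h)" using a by (simp add: real_sqrt_mult)
    finally have "L2_norm M (rank_one M E F (L2_class M h)) \<le> a * L2_norm M (L2_class M h)"
      unfolding R[OF h] norm_class[OF E1] norm_class[OF h] .
    then show ?thesis unfolding h_def L2_rep(2)[OF u] .
  qed
  show ?thesis
    unfolding BH_def mem_Collect_eq
    by (intro conjI allI ballI exI[of _ a]) (fact ext | rule add scale bound, assumption+)+
qed

section \<open>The support of the range\<close>

lemma compression_eq_zero_iff:
  assumes S: "S \<in> BH M" and E: "E \<in> sets M" and F: "F \<in> sets M"
  shows "op_comp M (proj_op M E) (op_comp M S (proj_op M F)) = op_zero M \<longleftrightarrow>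
    (\<forall>h\<in>sq_integrable M. AE s in M. s \<in> E \<longrightarrow> op_fun M S (\<lambda>t. indicator F t * h t) s = 0)"
    (is "?C = _ \<longleftrightarrow> _")
proof -
  have C: "?C (L2_class M h) = L2_zero M \<longleftrightarrow>
      (AE s in M. s \<in> E \<longrightarrow> op_fun M S (\<lambda>t. indicator F t * h t) s = 0)"
    if h: "h \<in> sq_integrable M" for h
  proof -
    note w = op_fun_in[OF S sq_integrable_indicator[OF h F]]
    have "?C (L2_class M h) = L2_class M (\<lambda>s. indicator E s * op_fun M S (\<lambda>t. indicator F t * h t) s)"
      unfolding proj_op_def
      by (rule sandwich_class[OF S h, where K = 1]) (use E F in \<open>auto simp: indicator_def\<close>)
    moreover have "L2_class M (\<lambda>s. indicator E s * op_fun M S (\<lambda>t. indicator F t * h t) s) = L2_zero M \<longleftrightarrow>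
        (AE s in M. indicator E s * op_fun M S (\<lambda>t. indicator F t * h t) s = 0)"
      unfolding L2_zero_def
      by (rule L2_class_eq_iff[OF sq_integrable_indicator[OF w E] sq_integrable_zero])
    moreover have "\<dots> \<longleftrightarrow> (AE s in M. s \<in> E \<longrightarrow> op_fun M S (\<lambda>t. indicator F t * h t) s = 0)"
      by (intro AE_cong) (auto simp: indicator_def)
    ultimately show ?thesis by simp
  qed
  have "?C = op_zero M \<longleftrightarrow> (\<forall>u\<in>L2 M. ?C u = L2_zero M)"
  proof
    assume "\<forall>u\<in>L2 M. ?C u = L2_zero M"
    then show "?C = op_zero M"
      by (intro ext) (auto simp: op_zero_def op_comp_def compose_def restrict_def)
  qed (simp add: op_zero_def)
  also have "\<dots> \<longleftrightarrow> (\<forall>h\<in>sq_integrable M. ?C (L2_class M h) = L2_zero M)"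
  proof (intro iffI ballI)
    fix u assume *: "\<forall>h\<in>sq_integrable M. ?C (L2_class M h) = L2_zero M" and u: "u \<in> L2 M"
    show "?C u = L2_zero M" using * L2_rep(1)[OF u] L2_rep(2)[OF u] by metis
  qed (simp add: L2_class_in_L2)
  finally show ?thesis using C by simp
qed

text \<open>
  On a rectangle where the symbol is 1 the map fixes compressions, so the compression of the image of
  the rank-one operator between the indicator functions of \<open>F\<close> and \<open>E\<close> is this operator itself, which
  vanishes only if \<open>E\<close> or \<open>F\<close> is null.
\<close>

lemma (in finite_measure) null_if_unit_block_compressed_to_zero:
  assumes rep: "haagerup_rep M \<Phi> f g" and \<Phi>: "\<Phi> \<in> BH M \<rightarrow> BH M"
    and E: "E \<in> sets M" and F: "F \<in> sets M"
    and one: "\<And>s t. s \<in> E \<Longrightarrow> t \<in> F \<Longrightarrow> (\<Sum>n. f n s * g n t) = 1"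
    and zero: "\<And>S. S \<in> \<Phi> ` BH M \<Longrightarrow>
                 op_comp M (proj_op M E) (op_comp M S (proj_op M F)) = op_zero M"
  shows "E \<in> null_sets M \<or> F \<in> null_sets M"
proof -
  define T where "T = rank_one M E F"
  have T: "T \<in> BH M" unfolding T_def by (rule rank_one_in_BH[OF E F])
  have \<Phi>T: "\<Phi> T \<in> BH M" using \<Phi> T by (rule funcset_mem)
  note F1 = sq_integrable_indicator_one[OF F]
  have sq: "(\<lambda>t. indicator F t * indicator F t) = (indicator F :: 'a \<Rightarrow> complex)"
    by (auto simp: indicator_def)
  have int: "(LINT y|M. indicator F y * indicator F y :: complex) = measure M F"
  proof -
    have "(LINT y|M. complex_of_real (indicator F y)) = measure M F"
      using F by (subst integral_complex_of_real) simp
    then show ?thesis unfolding sq by (simp add: of_real_indicator)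
  qed
  have "op_fun M T (indicator F) =
      L2_rep (L2_class M (\<lambda>s. complex_of_real (measure M F) * indicator E s))"
    unfolding op_fun_def T_def rank_one_class[OF E F F1] int ..
  then have T_eq: "AE s in M. op_fun M T (indicator F) s = complex_of_real (measure M F) * indicator E s"
    using L2_rep_L2_class[OF sq_integrable_scale[OF sq_integrable_indicator_one[OF E]]] by simp
  have zero': "AE s in M. s \<in> E \<longrightarrow> op_fun M (\<Phi> T) (indicator F) s = 0"
    using zero[OF imageI[OF T]] F1 unfolding compression_eq_zero_iff[OF \<Phi>T E F]
    by (subst sq[symmetric]) blast
  have "AE s in M. s \<in> E \<longrightarrow> op_fun M (\<Phi> T) (indicator F) s = 1 * op_fun M T (indicator F) s"
    using one sets.sets_into_space[OF E]
    by (intro symbol_constant_compression_AE[of M \<Phi> f g T "indicator F" E F 1, OF rep T \<Phi>T F1])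
       auto
  with T_eq zero' have AE: "AE s in M. s \<in> E \<longrightarrow> measure M F = 0"
    by eventually_elim auto
  show ?thesis
  proof (cases "measure M F = 0")
    case True
    then show ?thesis using F by (auto simp: null_sets_def emeasure_eq_measure)
  next
    case False
    then have "AE s in M. s \<notin> E" using AE by simp
    then show ?thesis using E AE_iff_null_sets by blast
  qed
qed

text \<open>
  A rectangle that misses \<open>A\<close> becomes one where the symbol vanishes identically when the null set \<open>N\<close> is
  removed from its sides, and this does not change the compressions.
\<close>

lemma supports_zero_set_complement:
  assumes rep: "haagerup_rep M \<Phi> f g" and \<Phi>: "\<Phi> \<in> BH M \<rightarrow> BH M" and N: "N \<in> null_sets M"
    and eq: "\<And>s t. s \<in> space M - N \<Longrightarrow> t \<in> space M - N \<Longrightarrow> (s, t) \<notin> A \<Longrightarrow>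
               (\<Sum>n. f n s * g n t) = 0"
  shows "supports M (\<Phi> ` BH M) A"
  unfolding supports_def
proof (intro ballI impI)
  fix E F S assume E: "E \<in> sets M" and F: "F \<in> sets M" and EF: "E \<times> F \<inter> A = {}"
    and "S \<in> \<Phi> ` BH M"
  then obtain T where T: "T \<in> BH M" "S = \<Phi> T" by blast
  have S: "\<Phi> T \<in> BH M" using \<Phi> T(1) by (rule funcset_mem)
  have "AE s in M. s \<in> E \<longrightarrow> op_fun M (\<Phi> T) (\<lambda>t. indicator F t * h t) s = 0"
    if h: "h \<in> sq_integrable M" for h
  proof -
    have FN: "F - N \<in> sets M" using F N by auto
    have notN: "AE s in M. s \<notin> N" by (rule AE_not_in[OF N])
    have cut: "op_fun M (\<Phi> T) (\<lambda>t. indicator F t * h t) = op_fun M (\<Phi> T) (\<lambda>t. indicator (F - N) t * h t)"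
      by (rule op_fun_cong[OF sq_integrable_indicator[OF h F] sq_integrable_indicator[OF h FN]])
         (use notN in eventually_elim, auto simp: indicator_def)
    have "AE s in M. s \<in> E - N \<longrightarrow>
        op_fun M (\<Phi> T) (\<lambda>t. indicator (F - N) t * h t) s =
        0 * op_fun M T (\<lambda>t. indicator (F - N) t * h t) s"
    proof (rule symbol_constant_compression_AE[of M \<Phi> f g T _ _ "F - N",
          OF rep T(1) S sq_integrable_indicator[OF h FN]])
      fix s t assume "s \<in> E - N" "t \<in> F - N"
      then show "(\<Sum>n. f n s * g n t) = 0"
        using EF sets.sets_into_space[OF E] sets.sets_into_space[OF F] by (intro eq) auto
    qed (use sets.sets_into_space[OF E] in auto)
    then show ?thesis
      unfolding cut using notN by eventually_elim auto
  qed
  then show "op_comp M (proj_op M E) (op_comp M S (proj_op M F)) = op_zero M"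
    unfolding T(2) using compression_eq_zero_iff[OF S E F] by blast
qed

lemma marg_nullI:
  assumes "R \<subseteq> space M \<times> space M" "N \<in> null_sets M"
    and "\<And>s t. (s, t) \<in> R \<Longrightarrow> s \<in> N \<or> t \<in> N"
  shows "marg_null M R"
  unfolding marg_null_def using assms by (intro conjI bexI[of _ N]) auto

lemma marg_nullE:
  assumes "marg_null M R"
  obtains N where "N \<in> null_sets M" "\<forall>(s, t)\<in>R. s \<in> N \<or> t \<in> N"
  using assms unfolding marg_null_def by blast

lemma omega_openI:
  assumes "countable \<R>" "\<R> \<subseteq> sets M \<times> sets M"
    and "G \<subseteq> space M \<times> space M" "marg_equiv M G (\<Union>(B, D)\<in>\<R>. B \<times> D)"
  shows "omega_open M G"
proof -
  \<comment> \<open>The empty rectangle makes the family nonempty, so that it can be enumerated.\<close>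
  define r where "r = from_nat_into (insert ({}, {}) \<R>)"
  have r: "range r = insert ({}, {}) \<R>"
    unfolding r_def using assms(1) by (intro range_from_nat_into) auto
  have "(\<Union>n. fst (r n) \<times> snd (r n)) = (\<Union>(B, D)\<in>range r. B \<times> D)" by (simp add: case_prod_beta)
  also have "\<dots> = (\<Union>(B, D)\<in>\<R>. B \<times> D)" unfolding r by auto
  finally have "marg_equiv M G (\<Union>n. fst (r n) \<times> snd (r n))" using assms(4) by simp
  moreover have "r n \<in> sets M \<times> sets M" for n
    using r assms(2) by (metis (no_types, lifting) insertE mem_Sigma_iff rangeI sets.empty_sets subsetD)
  then have "range (\<lambda>n. fst (r n)) \<subseteq> sets M" "range (\<lambda>n. snd (r n)) \<subseteq> sets M"
    by (auto simp: mem_Times_iff)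
  ultimately show ?thesis unfolding omega_open_def using assms(3) by blast
qed

text \<open>
  Rectangles inside \<open>A\<close> and rectangles disjoint from \<open>A\<close> together cover the product space up to a
  marginally null set. The latter show that \<open>A\<close> is \<open>\<omega>\<close>-closed. The former, cut down by the rectangles
  exhausting the complement of a competing set \<open>\<Omega>\<close>, have to be marginally null.
\<close>

lemma (in finite_measure) is_omega_support_indicator_symbol:
  assumes rep: "haagerup_rep M \<Phi> f g" and \<Phi>: "\<Phi> \<in> BH M \<rightarrow> BH M"
    and A: "A \<subseteq> space M \<times> space M" and sym: "mae_eq M (indicator A) (\<lambda>(s, t). \<Sum>n. f n s * g n t)"
  shows "is_omega_support M (\<Phi> ` BH M) A"
proof -
  obtain C where f: "bounded_l2_family M C f" and g: "bounded_l2_family M C g"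
    using haagerup_rep_bounded_l2_family[OF rep] .
  obtain N where N: "N \<in> null_sets M"
    and off_N: "\<forall>(s, t)\<in>{p \<in> space M \<times> space M. indicator A p \<noteq> (case p of (s, t) \<Rightarrow> \<Sum>n. f n s * g n t)}.
                  s \<in> N \<or> t \<in> N"
    using sym unfolding mae_eq_def by (rule marg_nullE)
  have eq: "(\<Sum>n. f n s * g n t) = indicator A (s, t)"
    if "s \<in> space M - N" "t \<in> space M - N" for s t
  proof -
    have "\<not> (s \<in> N \<or> t \<in> N)" "(s, t) \<in> space M \<times> space M" using that by auto
    with off_N show ?thesis by fastforce
  qed
  obtain \<R> where R: "countable \<R>" "\<R> \<subseteq> sets M \<times> sets M"
    "(\<Union>(B, D)\<in>\<R>. B \<times> D) = (space M - N) \<times> (space M - N)"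
    "\<And>B D. (B, D) \<in> \<R> \<Longrightarrow> B \<times> D \<subseteq> A \<or> B \<times> D \<inter> A = {}"
    using indicator_symbol_blocks[OF f g null_setsD2[OF N] eq] by blast
  have closed: "omega_closed M A"
  proof -
    define \<R>\<^sub>0 where "\<R>\<^sub>0 = {p \<in> \<R>. (fst p \<times> snd p) \<inter> A = {}}"
    have "(\<Union>(B, D)\<in>\<R>\<^sub>0. B \<times> D) = (space M - N) \<times> (space M - N) - A"
      unfolding R(3)[symmetric] \<R>\<^sub>0_def using R(4) by fastforce
    then have "marg_equiv M (space M \<times> space M - A) (\<Union>(B, D)\<in>\<R>\<^sub>0. B \<times> D)"
      unfolding marg_equiv_def by (intro marg_nullI[OF _ N]) auto
    moreover have "countable \<R>\<^sub>0" "\<R>\<^sub>0 \<subseteq> sets M \<times> sets M" using R(1,2) by (auto simp: \<R>\<^sub>0_def)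
    ultimately show ?thesis
      unfolding omega_closed_def using A by (auto intro: omega_openI)
  qed
  moreover have "supports M (\<Phi> ` BH M) A"
    using eq by (intro supports_zero_set_complement[OF rep \<Phi> N]) (auto simp: indicator_def)
  moreover have "marg_null M (A - \<Omega>)" if \<Omega>: "omega_closed M \<Omega>" "supports M (\<Phi> ` BH M) \<Omega>" for \<Omega>
  proof -
    obtain \<alpha> \<beta> :: "nat \<Rightarrow> 'a set" where ab: "range \<alpha> \<subseteq> sets M" "range \<beta> \<subseteq> sets M"
      and comp: "marg_equiv M (space M \<times> space M - \<Omega>) (\<Union>n. \<alpha> n \<times> \<beta> n)"
      using \<Omega>(1) unfolding omega_closed_def omega_open_def by blast
    obtain N' where N': "N' \<in> null_sets M"
      and N'_cover: "\<forall>(s, t)\<in>(space M \<times> space M - \<Omega> - (\<Union>n. \<alpha> n \<times> \<beta> n)) \<union>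
          ((\<Union>n. \<alpha> n \<times> \<beta> n) - (space M \<times> space M - \<Omega>)). s \<in> N' \<or> t \<in> N'"
      using comp unfolding marg_equiv_def by (rule marg_nullE)
    \<comment> \<open>\<open>\<E>\<close> consists of the sides of all pieces of blocks that miss \<open>\<Omega>\<close>; each piece inside \<open>A\<close> has a null side,
    and \<open>Z\<close> collects these null sides and the two exceptional sets.\<close>
    define \<E> where "\<E> = (\<lambda>((B, D), n). B \<inter> \<alpha> n - N') ` (\<R> \<times> UNIV) \<union> (\<lambda>((B, D), n). D \<inter> \<beta> n - N') ` (\<R> \<times> UNIV)"
    define Z where "Z = N \<union> N' \<union> \<Union>(\<E> \<inter> null_sets M)"
    have "countable \<E>" unfolding \<E>_def using R(1) by auto
    then have "\<Union>(\<E> \<inter> null_sets M) \<in> null_sets M" using null_sets_UN'[of "\<E> \<inter> null_sets M" id M] by simp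
    then have Z: "Z \<in> null_sets M" unfolding Z_def using N N' by auto
    show ?thesis
    proof (rule marg_nullI[OF _ Z])
      show "A - \<Omega> \<subseteq> space M \<times> space M" using A by blast
      fix s t assume st: "(s, t) \<in> A - \<Omega>"
      show "s \<in> Z \<or> t \<in> Z"
      proof (rule ccontr)
        assume "\<not> (s \<in> Z \<or> t \<in> Z)"
        then have notZ: "s \<notin> Z" "t \<notin> Z" by auto
        then have notN: "s \<notin> N" "t \<notin> N" "s \<notin> N'" "t \<notin> N'" by (auto simp: Z_def)
        have sp: "s \<in> space M" "t \<in> space M" using st A by auto
        obtain n where n: "s \<in> \<alpha> n" "t \<in> \<beta> n" using N'_cover st sp notN by blast
        have "(s, t) \<in> (\<Union>(B, D)\<in>\<R>. B \<times> D)" unfolding R(3) using sp notN by blast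
        then obtain B D where BD: "(B, D) \<in> \<R>" "s \<in> B" "t \<in> D" by blast
        define E where "E = B \<inter> \<alpha> n - N'"
        define F where "F = D \<inter> \<beta> n - N'"
        have BD_A: "B \<times> D \<subseteq> A" using R(4)[OF BD(1)] BD(2,3) st by blast
        have BD_N: "B \<times> D \<subseteq> (space M - N) \<times> (space M - N)" unfolding R(3)[symmetric] using BD(1) by blast
        have "B \<in> sets M" "D \<in> sets M" "\<alpha> n \<in> sets M" "\<beta> n \<in> sets M" "N' \<in> sets M"
          using R(2) BD(1) ab null_setsD2[OF N'] by auto
        then have EF: "E \<in> sets M" "F \<in> sets M" unfolding E_def F_def by auto
        have disj: "E \<times> F \<inter> \<Omega> = {}" using N'_cover unfolding E_def F_def by blast
        have "E \<in> null_sets M \<or> F \<in> null_sets M"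
        proof (rule null_if_unit_block_compressed_to_zero[OF rep \<Phi> EF])
          fix x y assume "x \<in> E" "y \<in> F"
          then have xy: "(x, y) \<in> B \<times> D" by (auto simp: E_def F_def)
          then have "x \<in> space M - N" "y \<in> space M - N" using BD_N by blast+
          then show "(\<Sum>n. f n x * g n y) = 1" using eq[of x y] BD_A xy by (auto simp: indicator_def)
        next
          fix S assume "S \<in> \<Phi> ` BH M"
          then show "op_comp M (proj_op M E) (op_comp M S (proj_op M F)) = op_zero M"
            using \<Omega>(2) EF disj unfolding supports_def by blast
        qed
        moreover have "E \<in> \<E>"
          unfolding \<E>_def E_def by (intro UnI1 image_eqI[of _ _ "((B, D), n)"]) (use BD(1) in simp_all)
        moreover have "F \<in> \<E>"
          unfolding \<E>_def F_def by (intro UnI2 image_eqI[of _ _ "((B, D), n)"]) (use BD(1) in simp_all)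
        ultimately have "E \<subseteq> Z \<or> F \<subseteq> Z" unfolding Z_def by blast
        moreover have "s \<in> E" "t \<in> F" using BD n notN by (auto simp: E_def F_def)
        ultimately show False using notZ by blast
      qed
    qed
  qed
  ultimately show ?thesis unfolding is_omega_support_def by blast
qed

lemma is_omega_support_unique:
  assumes "is_omega_support M \<S> \<Omega>" "is_omega_support M \<S> \<Omega>'"
  shows "marg_equiv M \<Omega> \<Omega>'"
proof -
  have null: "marg_null M (\<Omega> - \<Omega>')" "marg_null M (\<Omega>' - \<Omega>)"
    using assms unfolding is_omega_support_def by blast+
  obtain N where N: "N \<in> null_sets M" "\<forall>(s, t)\<in>\<Omega> - \<Omega>'. s \<in> N \<or> t \<in> N"
    using null(1) by (rule marg_nullE)
  obtain N' where N': "N' \<in> null_sets M" "\<forall>(s, t)\<in>\<Omega>' - \<Omega>. s \<in> N' \<or> t \<in> N'"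
    using null(2) by (rule marg_nullE)
  have "\<Omega> \<subseteq> space M \<times> space M" "\<Omega>' \<subseteq> space M \<times> space M"
    using assms unfolding is_omega_support_def omega_closed_def by blast+
  then show ?thesis
    unfolding marg_equiv_def
    by (intro marg_nullI[OF _ null_sets.Un[OF N(1) N'(1)]]) (use N(2) N'(2) in blast)+
qed

theorem proposition12:
  fixes M :: "'a measure" and P :: "'a l2op \<Rightarrow> 'a l2op" and A :: "('a \<times> 'a) set"
  assumes "standard_borel_measure M" and "finite_measure M"
    and "P \<in> NCB M" and "idempotent_map M P"
    and "A \<subseteq> space M \<times> space M" and "indicator A \<in> symbol_class M P"
  shows "(\<exists>\<Omega>. is_omega_support M (P ` BH M) \<Omega>) \<and>
         (\<forall>\<Omega>. is_omega_support M (P ` BH M) \<Omega> \<longrightarrow> marg_equiv M A \<Omega>)"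
proof -
  obtain f g where rep: "haagerup_rep M P f g"
    and sym: "mae_eq M (indicator A) (\<lambda>(s, t). \<Sum>n. f n s * g n t)"
    using assms(6) unfolding symbol_class_def by blast
  have "P \<in> BH M \<rightarrow> BH M" using assms(3) unfolding NCB_def by blast
  from finite_measure.is_omega_support_indicator_symbol[OF assms(2) rep this assms(5) sym]
  show ?thesis using is_omega_support_unique by blast
qed

end
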